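(* Let $\{p_n\}_{n\ge1}$, $\{q_n\}_{n\ge1}$ be complex sequences with $\sum_{n=1}^\infty(|p_n|+|q_n|)<\infty$, and let $\alpha\ne\beta$ be complex numbers (so $\alpha/\beta\in\widehat{\mathbb{C}}$). Put $\varepsilon_n=\max\left(\sum_{i>n}|p_i|,\sum_{i>n}|q_i|\right)$. Let $P_n,Q_n$ be the numerator and denominator convergents, and $f_n=P_n/Q_n$ the classical approximants, of the continued fraction $$\frac{-\alpha\beta+q_1}{\alpha+\beta+p_1}\;{\atop+}\;\frac{-\alpha\beta+q_2}{\alpha+\beta+p_2}\;{\atop+}\;\frac{-\alpha\beta+q_3}{\alpha+\beta+p_3}\;{\atop+}\;\cdots .$$ Consider the limits $$a=a(\alpha,\beta)=\lim_{n\to\infty}\alpha^{-n}(P_n-\beta P_{n-1}),\qquad b=b(\alpha,\beta)=-\lim_{n\to\infty}\beta^{-n}(P_n-\alpha P_{n-1}),$$ $$c=c(\alpha,\beta)=\lim_{n\to\infty}\alpha^{-n}(Q_n-\beta Q_{n-1}),\qquad d=d(\alpha,\beta)=-\lim_{n\to\infty}\beta^{-n}(Q_n-\alpha Q_{n-1}).$$ When $|\alpha|=|\beta|\ne0$ all four limits exist, $b(\alpha,\beta)=-a(\beta,\alpha)$ and $d(\alpha,\beta)=-c(\beta,\alpha)$; the limits for $a$ and $c$ exist if $|\alpha|>|\beta|$, while the limits for $b$ and $d$ exist if $|\alpha|<|\beta|$. The sequential closure in $\widehat{\mathbb{C}}$ of the sequence of approximants of the continued fraction equals $$\frac{a\mathbb{T}_{\alpha/\beta}+b}{c\mathbb{T}_{\alpha/\beta}+d}.$$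 Assuming $|\alpha|=|\beta|\ne0$ and $q_n\ne\alpha\beta$ for all $n\ge1$, $$f_n\asymp h\left((\alpha/\beta)^{n+1}\right)\quad\text{where}\quad h(z)=\frac{az+b}{cz+d},$$ and $$\det(h)=ad-bc=(\beta-\alpha)\prod_{n=1}^\infty\left(1-\frac{q_n}{\alpha\beta}\right).$$ Moreover, when $|\alpha|=|\beta|\ne0$, if either $|c|\ne|d|$, or else $|c|=|d|$, $\alpha/\beta$ is a primitive $m$th root of unity and $c\alpha^n+d\beta^n\ne0$ for $0\le n<m$, then as $n\to\infty$ $$\left|f_n-h\left((\alpha/\beta)^{n+1}\right)\right|=O(\varepsilon_n).$$ Finally, when $|\alpha|=|\beta|=1$, as $n\to\infty$ $$\left|P_n-\frac{a\alpha^{n+1}+b\beta^{n+1}}{\alpha-\beta}\right|=O(\varepsilon_n)\quad\text{and}\quad \left|Q_n-\frac{c\alpha^{n+1}+d\beta^{n+1}}{\alpha-\beta}\right|=O(\varepsilon_n).$$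
   Context: $\widehat{\mathbb{C}}=\mathbb{C}\cup\{\infty\}$ is the Riemann sphere with the chordal metric. For sequences in a metric space $(X,d)$, $s_n\asymp t_n$ means $d(s_n,t_n)\to0$ (above, in $\widehat{\mathbb{C}}$). The sequential closure $\copyright(s_n)$ of a sequence is the set of limits of its convergent subsequences. The continued fraction $\frac{a_1}{b_1}{\atop+}\frac{a_2}{b_2}{\atop+}\cdots$ means $a_1/(b_1+a_2/(b_2+\cdots))$. Its convergents are defined by $P_{-1}=1$, $P_0=0$, $Q_{-1}=0$, $Q_0=1$, $P_n=b_nP_{n-1}+a_nP_{n-2}$, $Q_n=b_nQ_{n-1}+a_nQ_{n-2}$; here $a_n=-\alpha\beta+q_n$, $b_n=\alpha+\beta+p_n$. It is assumed throughout that at most one partial numerator $a_n$ vanishes and that $(a_n,b_n)\ne(0,0)$ for all $n$. If $a_N=0$, the continued fraction is finite and converges to $P_{N-1}/Q_{N-1}$. For $\lambda\in\widehat{\mathbb{C}}$, $\mathbb{T}_\lambda=\copyright(\lambda^n)\subset\widehat{\mathbb{C}}$; that is, $\mathbb{T}_\lambda=\{0\}$ if $|\lambda|<1$; $\mathbb{T}_\lambda$ is the unit circle if $|\lambda|=1$ and $\lambda$ is not a root of unity; $\mathbb{T}_\lambda=\{e^{2\pi ik/m}:0\le k<m\}$ if $\lambda$ is a primitive $m$th root of unity; $\mathbb{T}_\lambda=\{\infty\}$ if $|\lambda|>1$. The expression $\frac{a\mathbb{T}_\lambda+b}{c\mathbb{T}_\lambda+d}$ denotes the set $\{(az+b)/(cz+d):z\in\mathbb{T}_\lambda\}$;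 possibly non-existent limits are annihilated by $\mathbb{T}_{\alpha/\beta}$, i.e. it is $\{a/c\}$ when $|\alpha|>|\beta|$ and $\{b/d\}$ when $|\alpha|<|\beta|$.
   Formalization: If some partial numerator vanishes and |α|≠|β|, the sequential closure formula is claimed only when the value a/c (or b/d) is not 0/0; if |α|=|β|, points of T at which (az+b)/(cz+d) is 0/0 are left out of the set. *)

theory Defs
  imports "HOL-Analysis.Analysis" "HOL-Library.Landau_Symbols"
begin

section \<open>The Riemann sphere with the chordal metric\<close>

datatype sphere = Fin (the_fin: complex) | Infty

fun stereo :: "sphere \<Rightarrow> complex \<times> real" where
  "stereo (Fin z) =
     (of_real (2 / (1 + (cmod z)\<^sup>2)) * z, ((cmod z)\<^sup>2 - 1) / ((cmod z)\<^sup>2 + 1))"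
| "stereo Infty = (0, 1)"

lemma one_plus_cmod_sq_pos: "1 + (cmod z)\<^sup>2 > 0"
  by (simp add: add_pos_nonneg)

lemma stereo_height: "snd (stereo (Fin z)) = 1 - 2 / (1 + (cmod z)\<^sup>2)"
  using one_plus_cmod_sq_pos[of z] by (simp add: field_simps)

lemma stereo_inj: "stereo x = stereo y \<longleftrightarrow> x = y"
proof
  assume eq: "stereo x = stereo y"
  have pos: "2 / (1 + (cmod z)\<^sup>2) > 0" for z
    using one_plus_cmod_sq_pos[of z] by simp
  show "x = y"
  proof (cases x; cases y)
    fix z w assume xy: "x = Fin z" "y = Fin w"
    with eq have h: "2 / (1 + (cmod z)\<^sup>2) = 2 / (1 + (cmod w)\<^sup>2)"
      using stereo_height[of z] stereo_height[of w] by simp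
    have "of_real (2 / (1 + (cmod z)\<^sup>2)) * z = of_real (2 / (1 + (cmod w)\<^sup>2)) * w"
      using eq xy by simp
    then have "of_real (2 / (1 + (cmod z)\<^sup>2)) * z = of_real (2 / (1 + (cmod z)\<^sup>2)) * w"
      by (simp only: h)
    moreover have "complex_of_real (2 / (1 + (cmod z)\<^sup>2)) \<noteq> 0"
      unfolding of_real_eq_0_iff using pos[of z] by linarith
    ultimately have "z = w" by (metis mult_left_cancel)
    with xy show ?thesis by simp
  next
    fix z assume "x = Fin z" "y = Infty"
    with eq stereo_height[of z] pos[of z] show ?thesis by simp
  next
    fix w assume "x = Infty" "y = Fin w"
    with eq stereo_height[of w] pos[of w] show ?thesis
      by (metis less_irrefl diff_eq_eq add_cancel_right_right snd_conv stereo.simps(2))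
  qed simp
qed simp

instantiation sphere :: metric_space
begin

definition dist_sphere :: "sphere \<Rightarrow> sphere \<Rightarrow> real" where
  "dist_sphere x y = dist (stereo x) (stereo y)"

definition uniformity_sphere :: "(sphere \<times> sphere) filter" where
  "uniformity_sphere = (INF e\<in>{0<..}. principal {(x, y). dist x y < e})"

definition open_sphere :: "sphere set \<Rightarrow> bool" where
  "open_sphere U \<longleftrightarrow> (\<forall>x\<in>U. eventually (\<lambda>(x', y). x' = x \<longrightarrow> y \<in> U) uniformity)"

instance
proof
  fix x y z :: sphere
  show "dist x y = 0 \<longleftrightarrow> x = y"
    by (simp add: dist_sphere_def stereo_inj)
  show "dist x y \<le> dist x z + dist y z"
    unfolding dist_sphere_def by (rule dist_triangle2)
qed (fact uniformity_sphere_def open_sphere_def)+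

end

lemma dist_Fin_Infty: "dist (Fin z) Infty = 2 / sqrt (1 + (cmod z)\<^sup>2)"
proof -
  define s where "s = 1 + (cmod z)\<^sup>2"
  have s: "s > 0" using one_plus_cmod_sq_pos[of z] by (simp add: s_def)
  have n: "(cmod z)\<^sup>2 = s - 1" by (simp add: s_def)
  have "stereo (Fin z) = (of_real (2 / s) * z, 1 - 2 / s)"
    using stereo_height[of z] by (simp add: s_def)
  then have "(dist (Fin z) Infty)\<^sup>2 = (cmod (of_real (2 / s) * z))\<^sup>2 + (- (2 / s))\<^sup>2"
    unfolding dist_sphere_def using s by (simp del: stereo.simps(1) add: dist_prod_def dist_norm)
  also have "\<dots> = (2 / s)\<^sup>2 * (cmod z)\<^sup>2 + (2 / s)\<^sup>2"
    using s by (simp add: norm_mult power_mult_distrib norm_divide power_divide)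
  also have "\<dots> = 4 / s"
    unfolding n using s by (simp add: field_simps power2_eq_square)
  finally have "dist (Fin z) Infty = sqrt (4 / s)"
    by (metis real_sqrt_abs abs_of_nonneg zero_le_dist)
  then show ?thesis by (simp add: real_sqrt_divide s_def)
qed

lemma dist_Fin_Fin:
  "dist (Fin z) (Fin w) =
     2 * cmod (z - w) / (sqrt (1 + (cmod z)\<^sup>2) * sqrt (1 + (cmod w)\<^sup>2))"
proof -
  define s t where "s = 1 + (cmod z)\<^sup>2" and "t = 1 + (cmod w)\<^sup>2"
  have s: "s > 0" and t: "t > 0"
    using one_plus_cmod_sq_pos[of z] one_plus_cmod_sq_pos[of w] by (auto simp: s_def t_def)
  have n: "(cmod z)\<^sup>2 = s - 1" "(cmod w)\<^sup>2 = t - 1" by (auto simp: s_def t_def)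
  define k where "k = z \<bullet> w"
  have zw: "(cmod (z - w))\<^sup>2 = s + t - 2 - 2 * k"
    using n dot_norm_neg[of z w] by (simp add: k_def)
  have A: "(cmod (of_real (2 / s) * z - of_real (2 / t) * w))\<^sup>2
      = (2 / s)\<^sup>2 * (s - 1) + (2 / t)\<^sup>2 * (t - 1) - 2 * (2 / s) * (2 / t) * k"
  proof -
    have "(cmod (of_real (2 / s) * z - of_real (2 / t) * w))\<^sup>2
        = (norm ((2 / s) *\<^sub>R z - (2 / t) *\<^sub>R w))\<^sup>2"
      by (simp only: scaleR_conv_of_real)
    also have "\<dots> = (2 / s)\<^sup>2 * (cmod z)\<^sup>2 + (2 / t)\<^sup>2 * (cmod w)\<^sup>2 - 2 * (2 / s) * (2 / t) * k"
      unfolding power2_norm_eq_inner k_def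
      by (simp only: inner_diff_left inner_diff_right inner_scaleR_left inner_scaleR_right
          inner_commute[of w z] power2_eq_square) (simp add: algebra_simps)
    finally show ?thesis by (simp only: n)
  qed
  have "(dist (Fin z) (Fin w))\<^sup>2
      = (cmod (of_real (2 / s) * z - of_real (2 / t) * w))\<^sup>2 + ((1 - 2 / s) - (1 - 2 / t))\<^sup>2"
    using stereo_height[of z] stereo_height[of w]
    by (simp add: dist_sphere_def dist_prod_def dist_norm s_def t_def)
  also have "\<dots> = 4 * (cmod (z - w))\<^sup>2 / (s * t)"
    unfolding A zw using s t by (simp add: field_simps power2_eq_square)
  finally have "dist (Fin z) (Fin w) = sqrt (4 * (cmod (z - w))\<^sup>2 / (s * t))"
    by (metis real_sqrt_abs abs_of_nonneg zero_le_dist)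
  then show ?thesis
    by (simp add: real_sqrt_divide real_sqrt_mult s_def t_def)
qed

text \<open>The quotient \<open>z / w\<close> as a point of the sphere; the value at \<open>0 / 0\<close> is meaningless.\<close>

definition cdiv :: "complex \<Rightarrow> complex \<Rightarrow> sphere" where
  "cdiv z w = (if w = 0 then Infty else Fin (z / w))"

fun sphere_pow :: "sphere \<Rightarrow> nat \<Rightarrow> sphere" where
  "sphere_pow (Fin z) n = Fin (z ^ n)"
| "sphere_pow Infty n = (if n = 0 then Fin 1 else Infty)"

text \<open>\<open>(a z + b) / (c z + d)\<close> is the quotient of \<open>lin_at a b z\<close> by \<open>lin_at c d z\<close>; at
  \<open>z = \<infinity>\<close> this is \<open>a / c\<close>.\<close>

fun lin_at :: "complex \<Rightarrow> complex \<Rightarrow> sphere \<Rightarrow> complex" where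
  "lin_at a b (Fin z) = a * z + b"
| "lin_at a b Infty = a"

definition lin_frac :: "complex \<Rightarrow> complex \<Rightarrow> complex \<Rightarrow> complex \<Rightarrow> sphere \<Rightarrow> sphere" where
  "lin_frac a b c d z = cdiv (lin_at a b z) (lin_at c d z)"

text \<open>Points of \<open>T\<close> at which the fraction is the indeterminate \<open>0 / 0\<close> contribute no value;
  there can be such points only if \<open>a d - b c = 0\<close>.\<close>

definition lin_frac_set ::
    "complex \<Rightarrow> complex \<Rightarrow> complex \<Rightarrow> complex \<Rightarrow> sphere set \<Rightarrow> sphere set" where
  "lin_frac_set a b c d T =
     {lin_frac a b c d z | z. z \<in> T \<and> (lin_at a b z, lin_at c d z) \<noteq> (0, 0)}"

section \<open>Sequences\<close>

definition seq_closure :: "(nat \<Rightarrow> 'a::metric_space) \<Rightarrow> 'a set" where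
  "seq_closure s = {l. \<exists>r::nat \<Rightarrow> nat. strict_mono r \<and> (s \<circ> r) \<longlonglongrightarrow> l}"

definition asymptotic :: "(nat \<Rightarrow> 'a::metric_space) \<Rightarrow> (nat \<Rightarrow> 'a) \<Rightarrow> bool" where
  "asymptotic s t \<longleftrightarrow> (\<lambda>n. dist (s n) (t n)) \<longlonglongrightarrow> 0"

definition power_limit_set :: "sphere \<Rightarrow> sphere set" where
  "power_limit_set l = seq_closure (\<lambda>n. sphere_pow l n)"

definition primitive_root_of_unity :: "nat \<Rightarrow> complex \<Rightarrow> bool" where
  "primitive_root_of_unity m z \<longleftrightarrow>
     m > 0 \<and> z ^ m = 1 \<and> (\<forall>k. 0 < k \<and> k < m \<longrightarrow> z ^ k \<noteq> 1)"

section \<open>Continued fractions\<close>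

text \<open>Partial numerators \<open>A n\<close> and partial denominators \<open>B n\<close> are indexed by \<open>n \<ge> 1\<close>; the
  entries at \<open>0\<close> are never used.  The second equations use \<open>P\<^sub>-\<^sub>1 = 1\<close> and \<open>Q\<^sub>-\<^sub>1 = 0\<close>.\<close>

fun cf_num :: "(nat \<Rightarrow> complex) \<Rightarrow> (nat \<Rightarrow> complex) \<Rightarrow> nat \<Rightarrow> complex" where
  "cf_num A B 0 = 0"
| "cf_num A B (Suc 0) = B 1 * cf_num A B 0 + A 1 * 1"
| "cf_num A B (Suc (Suc n)) =
     B (Suc (Suc n)) * cf_num A B (Suc n) + A (Suc (Suc n)) * cf_num A B n"

fun cf_den :: "(nat \<Rightarrow> complex) \<Rightarrow> (nat \<Rightarrow> complex) \<Rightarrow> nat \<Rightarrow> complex" where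
  "cf_den A B 0 = 1"
| "cf_den A B (Suc 0) = B 1 * cf_den A B 0 + A 1 * 0"
| "cf_den A B (Suc (Suc n)) =
     B (Suc (Suc n)) * cf_den A B (Suc n) + A (Suc (Suc n)) * cf_den A B n"

text \<open>\<open>P\<^sub>n = Q\<^sub>n = 0\<close> is only possible if some \<open>A N\<close> with \<open>1 \<le> N \<le> n\<close> vanishes.  The continued
  fraction is then finite with value \<open>P\<^sub>N\<^sub>-\<^sub>1 / Q\<^sub>N\<^sub>-\<^sub>1\<close>, and this value is used in place of
  \<open>0 / 0\<close>; it is also \<open>P\<^sub>n / Q\<^sub>n\<close> for all other \<open>n \<ge> N\<close>.\<close>

definition cf_approximant :: "(nat \<Rightarrow> complex) \<Rightarrow> (nat \<Rightarrow> complex) \<Rightarrow> nat \<Rightarrow> sphere" where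
  "cf_approximant A B n =
     (if cf_num A B n = 0 \<and> cf_den A B n = 0
      then let N = (LEAST N. 1 \<le> N \<and> A N = 0) in cdiv (cf_num A B (N - 1)) (cf_den A B (N - 1))
      else cdiv (cf_num A B n) (cf_den A B n))"

definition pert_A :: "(nat \<Rightarrow> complex) \<Rightarrow> complex \<Rightarrow> complex \<Rightarrow> nat \<Rightarrow> complex" where
  "pert_A q \<alpha> \<beta> n = - \<alpha> * \<beta> + q n"

definition pert_B :: "(nat \<Rightarrow> complex) \<Rightarrow> complex \<Rightarrow> complex \<Rightarrow> nat \<Rightarrow> complex" where
  "pert_B p \<alpha> \<beta> n = \<alpha> + \<beta> + p n"

definition pert_P ::
    "(nat \<Rightarrow> complex) \<Rightarrow> (nat \<Rightarrow> complex) \<Rightarrow> complex \<Rightarrow> complex \<Rightarrow> nat \<Rightarrow> complex" where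
  "pert_P p q \<alpha> \<beta> = cf_num (pert_A q \<alpha> \<beta>) (pert_B p \<alpha> \<beta>)"

definition pert_Q ::
    "(nat \<Rightarrow> complex) \<Rightarrow> (nat \<Rightarrow> complex) \<Rightarrow> complex \<Rightarrow> complex \<Rightarrow> nat \<Rightarrow> complex" where
  "pert_Q p q \<alpha> \<beta> = cf_den (pert_A q \<alpha> \<beta>) (pert_B p \<alpha> \<beta>)"

definition pert_f ::
    "(nat \<Rightarrow> complex) \<Rightarrow> (nat \<Rightarrow> complex) \<Rightarrow> complex \<Rightarrow> complex \<Rightarrow> nat \<Rightarrow> sphere" where
  "pert_f p q \<alpha> \<beta> = cf_approximant (pert_A q \<alpha> \<beta>) (pert_B p \<alpha> \<beta>)"

text \<open>The sequences whose limits (up to sign) are \<open>a\<close>, \<open>b\<close>, \<open>c\<close>, \<open>d\<close>, with \<open>n\<close> shifted by one to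
  avoid \<open>P\<^sub>-\<^sub>1\<close> and \<open>Q\<^sub>-\<^sub>1\<close>.\<close>

definition a_seq where
  "a_seq p q \<alpha> \<beta> n = (pert_P p q \<alpha> \<beta> (Suc n) - \<beta> * pert_P p q \<alpha> \<beta> n) / \<alpha> ^ Suc n"

definition b_seq where
  "b_seq p q \<alpha> \<beta> n = (pert_P p q \<alpha> \<beta> (Suc n) - \<alpha> * pert_P p q \<alpha> \<beta> n) / \<beta> ^ Suc n"

definition c_seq where
  "c_seq p q \<alpha> \<beta> n = (pert_Q p q \<alpha> \<beta> (Suc n) - \<beta> * pert_Q p q \<alpha> \<beta> n) / \<alpha> ^ Suc n"

definition d_seq where
  "d_seq p q \<alpha> \<beta> n = (pert_Q p q \<alpha> \<beta> (Suc n) - \<alpha> * pert_Q p q \<alpha> \<beta> n) / \<beta> ^ Suc n"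

definition a_lim where "a_lim p q \<alpha> \<beta> = lim (a_seq p q \<alpha> \<beta>)"
definition b_lim where "b_lim p q \<alpha> \<beta> = - lim (b_seq p q \<alpha> \<beta>)"
definition c_lim where "c_lim p q \<alpha> \<beta> = lim (c_seq p q \<alpha> \<beta>)"
definition d_lim where "d_lim p q \<alpha> \<beta> = - lim (d_seq p q \<alpha> \<beta>)"

definition tail_eps :: "(nat \<Rightarrow> complex) \<Rightarrow> (nat \<Rightarrow> complex) \<Rightarrow> nat \<Rightarrow> real" where
  "tail_eps p q n = max (\<Sum>i. cmod (p (n + 1 + i))) (\<Sum>i. cmod (q (n + 1 + i)))"

end

theory Submission
  imports Defs
begin

text \<open>Write \<open>X\<close> for \<open>P\<close> or \<open>Q\<close>.  Without the perturbations the recurrence is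
\<open>X\<^sub>n = (\<alpha> + \<beta>) X\<^sub>n\<^sub>-\<^sub>1 - \<alpha> \<beta> X\<^sub>n\<^sub>-\<^sub>2\<close>, with characteristic roots \<open>\<alpha>\<close> and \<open>\<beta>\<close>.
It is diagonalised by \<open>X\<^sub>n - \<beta> X\<^sub>n\<^sub>-\<^sub>1\<close> and \<open>X\<^sub>n - \<alpha> X\<^sub>n\<^sub>-\<^sub>1\<close>, which are then multiplied by \<open>\<alpha>\<close> and by
\<open>\<beta>\<close> in each step.  With the perturbations both receive the same additional term
\<open>p\<^sub>n X\<^sub>n\<^sub>-\<^sub>1 + q\<^sub>n X\<^sub>n\<^sub>-\<^sub>2\<close>.  Suppose \<open>|\<beta>| \<le> |\<alpha>|\<close> and divide everything by \<open>\<alpha>\<^sup>n\<close>.  The first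
combination becomes a constant plus a small defect, the second one is multiplied by \<open>\<beta> / \<alpha>\<close>, of modulus
at most one, plus the same defect, and the defect is at most a summable factor times the sum of the
two moduli.  A discrete Gronwall argument bounds this sum, so the first combination converges, with
an error that is at most a constant times the tail sum (\<open>component_limit\<close>, \<open>component_error\<close>).

If \<open>|\<beta>| < |\<alpha>|\<close>, the second combination tends to \<open>0\<close>.  Up to a common factor
\<open>(P\<^sub>n, Q\<^sub>n)\<close> therefore tends to \<open>(a, c)\<close>, and the approximants tend to \<open>a / c\<close> unless \<open>a = c = 0\<close>.
If no partial numerator vanishes, some linear combination of \<open>P\<close> and \<open>Q\<close> is, from a late time on,
almost a pure multiple of \<open>\<alpha>\<^sup>n\<close>, so its limit is not \<open>0\<close> and \<open>a = c = 0\<close> is impossible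
(\<open>dominant_limits_nonzero\<close>).  The case \<open>|\<alpha>| < |\<beta>|\<close> follows because the continued fraction is symmetric
in \<open>\<alpha>\<close> and \<open>\<beta>\<close>.

If \<open>|\<alpha>| = |\<beta>|\<close>, the estimate applies to both roots.  Up to a common factor
\<open>(P\<^sub>n, Q\<^sub>n)\<close> is \<open>(a \<rho>\<^sup>n\<^sup>+\<^sup>1 + b, c \<rho>\<^sup>n\<^sup>+\<^sup>1 + d)\<close> with \<open>\<rho> = \<alpha> / \<beta>\<close>, with an error that is a multiple of the tail sum.
All assertions about rates are read off from this.  Along a subsequence on
which \<open>\<rho>\<^sup>n\<^sup>+\<^sup>1\<close> tends to \<open>z\<close> the approximants tend to \<open>(a z + b) / (c z + d)\<close>, provided that this is not
\<open>0 / 0\<close>.  The determinant \<open>a d - b c\<close> is the limit of the normalised Casoratian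
\<open>P\<^sub>n Q\<^sub>n\<^sub>-\<^sub>1 - P\<^sub>n\<^sub>-\<^sub>1 Q\<^sub>n\<close>, which is, up to sign, the product of the first \<open>n\<close> partial numerators.
The resulting infinite product converges absolutely, so it is nonzero if no partial numerator
vanishes; this excludes \<open>0 / 0\<close>.  If one partial numerator vanishes, the approximants are eventually
constant, and it remains to see that the fraction is not \<open>0 / 0\<close> everywhere on the limit set of the
powers (\<open>linear_fractional_set_nonempty\<close>).\<close>

section \<open>The chordal metric in homogeneous coordinates\<close>

lemma cdiv_scale: "k \<noteq> 0 \<Longrightarrow> cdiv (k * x) (k * y) = cdiv x y"
  by (simp add: cdiv_def)

text \<open>In homogeneous coordinates the chordal distance has one formula for all points, including
infinity.  Convergence of quotients can thus be discussed without separating the case of a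
vanishing denominator.\<close>

lemma dist_cdiv:
  assumes "(x, y) \<noteq> (0, 0)" "(x', y') \<noteq> (0, 0)"
  shows "dist (cdiv x y) (cdiv x' y') = 2 * cmod (x * y' - x' * y) /
    (sqrt ((cmod x)\<^sup>2 + (cmod y)\<^sup>2) * sqrt ((cmod x')\<^sup>2 + (cmod y')\<^sup>2))"
proof -
  have root: "sqrt (1 + (cmod (u / v))\<^sup>2) = sqrt ((cmod u)\<^sup>2 + (cmod v)\<^sup>2) / cmod v"
    if "v \<noteq> 0" for u v
  proof -
    have "1 + (cmod (u / v))\<^sup>2 = ((cmod u)\<^sup>2 + (cmod v)\<^sup>2) / (cmod v)\<^sup>2"
      using that by (simp add: norm_divide field_simps)
    then show ?thesis by (simp add: real_sqrt_divide)
  qed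
  have infinite: "dist (cdiv u v) Infty = 2 * cmod v / sqrt ((cmod u)\<^sup>2 + (cmod v)\<^sup>2)"
    if "v \<noteq> 0" for u v
    using that by (simp add: cdiv_def dist_Fin_Infty root)
  consider "y = 0" "y' = 0" | "y \<noteq> 0" "y' = 0" | "y = 0" "y' \<noteq> 0" | "y \<noteq> 0" "y' \<noteq> 0"
    by blast
  then show ?thesis
  proof cases
    case 1
    then show ?thesis by (simp add: cdiv_def)
  next
    case 2
    then show ?thesis using infinite[of y x] assms by (simp add: cdiv_def[of x'] norm_mult)
  next
    case 3
    then show ?thesis using infinite[of y' x'] assms
      by (simp add: cdiv_def[of x] norm_mult dist_commute)
  next
    case 4
    have "cmod (x / y - x' / y') = cmod (x * y' - x' * y) / (cmod y * cmod y')"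
      using 4 by (simp add: diff_frac_eq norm_divide norm_mult)
    then show ?thesis
      using 4 by (simp add: cdiv_def dist_Fin_Fin root)
  qed
qed

lemma cdiv_eqI:
  assumes "(x, y) \<noteq> (0, 0)" "(x', y') \<noteq> (0, 0)" "x * y' = x' * y"
  shows "cdiv x y = cdiv x' y'"
  using dist_cdiv[OF assms(1,2)] assms(3) by simp

lemma tendsto_cdiv:
  assumes "(X \<longlongrightarrow> x) F" "(Y \<longlongrightarrow> y) F" "(x, y) \<noteq> (0, 0)"
  shows "((\<lambda>n. cdiv (X n) (Y n)) \<longlongrightarrow> cdiv x y) F"
proof -
  have pos: "(cmod x)\<^sup>2 + (cmod y)\<^sup>2 > 0"
    using assms(3) by (auto simp: sum_power2_gt_zero_iff)
  have "\<forall>\<^sub>F n in F. (cmod (X n))\<^sup>2 + (cmod (Y n))\<^sup>2 > 0"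
    by (rule order_tendstoD(1)[OF _ pos]) (intro tendsto_intros assms)
  then have "\<forall>\<^sub>F n in F. (X n, Y n) \<noteq> (0, 0)"
    by eventually_elim auto
  then have *: "\<forall>\<^sub>F n in F. 2 * cmod (X n * y - x * Y n) /
     (sqrt ((cmod (X n))\<^sup>2 + (cmod (Y n))\<^sup>2) * sqrt ((cmod x)\<^sup>2 + (cmod y)\<^sup>2)) = dist (cdiv (X n) (Y n)) (cdiv x y)"
    by eventually_elim (rule dist_cdiv[symmetric, OF _ assms(3)])
  have "((\<lambda>n. 2 * cmod (X n * y - x * Y n) /
     (sqrt ((cmod (X n))\<^sup>2 + (cmod (Y n))\<^sup>2) * sqrt ((cmod x)\<^sup>2 + (cmod y)\<^sup>2))) \<longlongrightarrow>
     2 * cmod (x * y - x * y) /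
     (sqrt ((cmod x)\<^sup>2 + (cmod y)\<^sup>2) * sqrt ((cmod x)\<^sup>2 + (cmod y)\<^sup>2))) F"
    using pos by (intro tendsto_intros assms) auto
  with * have "((\<lambda>n. dist (cdiv (X n) (Y n)) (cdiv x y)) \<longlongrightarrow> 0) F"
    by (simp add: filterlim_cong)
  then show ?thesis by (rule tendsto_dist_iff[THEN iffD2])
qed

lemma tendsto_Fin: "(g \<longlongrightarrow> z) F \<Longrightarrow> ((\<lambda>n. Fin (g n)) \<longlongrightarrow> Fin z) F"
  using tendsto_cdiv[of g z F "\<lambda>_. 1" 1] by (simp add: cdiv_def)

section \<open>Subsequential limits of powers\<close>

lemma seq_closure_convergent:
  assumes "s \<longlonglongrightarrow> l"
  shows "seq_closure s = {l}"
proof (intro equalityI subsetI)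
  fix x assume "x \<in> seq_closure s"
  then obtain r where r: "strict_mono r" "(s \<circ> r) \<longlonglongrightarrow> x"
    unfolding seq_closure_def mem_Collect_eq by (elim exE conjE)
  have "x = l" using LIMSEQ_unique[OF r(2) LIMSEQ_subseq_LIMSEQ[OF assms r(1)]] .
  then show "x \<in> {l}" by simp
next
  fix x assume "x \<in> {l}"
  then have "(s \<circ> id) \<longlonglongrightarrow> x" using assms by simp
  with strict_mono_id show "x \<in> seq_closure s"
    unfolding seq_closure_def mem_Collect_eq by (intro exI[of _ id] conjI)
qed

text \<open>Asymptotic equality is checked in this form because both sequences are only controlled along
subsequences on which the powers of \<open>\<alpha> / \<beta>\<close> converge.\<close>

lemma tendsto_zero_by_subsequences:
  fixes g :: "nat \<Rightarrow> real"
  assumes sub: "\<And>r :: nat \<Rightarrow> nat. strict_mono r \<Longrightarrow>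
    \<exists>t :: nat \<Rightarrow> nat. strict_mono t \<and> (\<lambda>n. g (r (t n))) \<longlonglongrightarrow> 0"
  shows "g \<longlonglongrightarrow> 0"
proof (rule ccontr)
  assume "\<not> g \<longlonglongrightarrow> 0"
  then obtain e where e: "e > 0" "\<not> (\<forall>\<^sub>F n in sequentially. dist (g n) 0 < e)"
    by (auto simp: tendsto_iff)
  then have "\<exists>\<^sub>F n in sequentially. e \<le> dist (g n) 0"
    by (simp add: not_eventually not_less)
  then have "infinite {n. e \<le> dist (g n) 0}"
    by (simp add: frequently_cofinite flip: cofinite_eq_sequentially)
  then obtain r :: "nat \<Rightarrow> nat" where r: "strict_mono r" "\<And>n. r n \<in> {n. e \<le> dist (g n) 0}"
    using infinite_enumerate by blast
  obtain t :: "nat \<Rightarrow> nat" where t: "(\<lambda>n. g (r (t n))) \<longlonglongrightarrow> 0"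
    using sub[OF r(1)] by blast
  have "\<forall>\<^sub>F n in sequentially. dist (g (r (t n))) 0 < e"
    using t e(1) by (rule tendstoD)
  then obtain n where "dist (g (r (t n))) 0 < e" by (auto simp: eventually_sequentially)
  with r(2)[of "t n"] show False by simp
qed

lemma power_limit_set_gt_1:
  assumes "cmod \<beta> < cmod \<alpha>"
  shows "power_limit_set (cdiv \<alpha> \<beta>) = {Infty}"
proof -
  have nz: "\<alpha> \<noteq> 0" using assms by auto
  have "cmod (\<beta> / \<alpha>) < 1" using assms nz by (simp add: norm_divide)
  then have "(\<lambda>n. cdiv 1 ((\<beta> / \<alpha>) ^ n)) \<longlonglongrightarrow> cdiv 1 0"
    by (intro tendsto_cdiv[OF tendsto_const LIMSEQ_power_zero]) auto
  also have "(\<lambda>n. cdiv 1 ((\<beta> / \<alpha>) ^ n)) = sphere_pow (cdiv \<alpha> \<beta>)"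
    using nz by (simp add: fun_eq_iff cdiv_def power_divide)
  also have "cdiv 1 0 = Infty" by (simp add: cdiv_def)
  finally show ?thesis
    unfolding power_limit_set_def by (rule seq_closure_convergent)
qed

lemma power_limit_set_lt_1:
  assumes "cmod \<alpha> < cmod \<beta>"
  shows "power_limit_set (cdiv \<alpha> \<beta>) = {Fin 0}"
proof -
  have nz: "\<beta> \<noteq> 0" using assms by auto
  have "cmod (\<alpha> / \<beta>) < 1" using assms nz by (simp add: norm_divide)
  then have "(\<lambda>n. Fin ((\<alpha> / \<beta>) ^ n)) \<longlonglongrightarrow> Fin 0"
    by (rule tendsto_Fin[OF LIMSEQ_power_zero])
  also have "(\<lambda>n. Fin ((\<alpha> / \<beta>) ^ n)) = sphere_pow (cdiv \<alpha> \<beta>)"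
    using nz by (simp add: fun_eq_iff cdiv_def)
  finally show ?thesis
    unfolding power_limit_set_def by (rule seq_closure_convergent)
qed

lemma unimodular_convergent_subsequence:
  fixes g :: "nat \<Rightarrow> complex"
  assumes "\<And>n. cmod (g n) = 1"
  obtains z and r :: "nat \<Rightarrow> nat" where "cmod z = 1" "strict_mono r" "(g \<circ> r) \<longlonglongrightarrow> z"
proof -
  have "seq_compact (sphere (0::complex) 1)"
    by (simp flip: compact_eq_seq_compact_metric)
  moreover have "\<forall>n. g n \<in> sphere 0 1" using assms by simp
  ultimately obtain z and r :: "nat \<Rightarrow> nat"
    where "z \<in> sphere 0 1" "strict_mono r" "(g \<circ> r) \<longlonglongrightarrow> z"
    by (rule seq_compactE)
  then show ?thesis by (intro that[of z r]) simp_all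
qed

text \<open>If the powers converge on the sphere along a subsequence, then a further subsequence converges in
the unit circle, which is compact; so all limit points are finite and are limits in the plane.\<close>

lemma power_limit_set_unimodular:
  assumes "cmod l = 1"
  shows "power_limit_set (Fin l) =
    {Fin z | z. \<exists>r::nat \<Rightarrow> nat. strict_mono r \<and> (\<lambda>n. l ^ r n) \<longlonglongrightarrow> z}" (is "_ = ?T")
proof
  show "?T \<subseteq> power_limit_set (Fin l)"
  proof
    fix x assume "x \<in> ?T"
    then obtain z r where r: "x = Fin z" "strict_mono r" "(\<lambda>n. l ^ r n) \<longlonglongrightarrow> z" by blast
    have "(\<lambda>n. Fin (l ^ r n)) \<longlonglongrightarrow> Fin z" by (rule tendsto_Fin) (rule r)
    then show "x \<in> power_limit_set (Fin l)"
      using r(1,2) by (auto simp: power_limit_set_def seq_closure_def o_def)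
  qed
  show "power_limit_set (Fin l) \<subseteq> ?T"
  proof
    fix x assume "x \<in> power_limit_set (Fin l)"
    then obtain r where r: "strict_mono r" "(\<lambda>n. Fin (l ^ r n)) \<longlonglongrightarrow> x"
      by (auto simp: power_limit_set_def seq_closure_def o_def)
    obtain z t where t: "strict_mono t" "((\<lambda>n. l ^ r n) \<circ> t) \<longlonglongrightarrow> z"
      by (rule unimodular_convergent_subsequence[of "\<lambda>n. l ^ r n"])
        (simp_all add: norm_power assms)
    have "(\<lambda>n. Fin (l ^ r (t n))) \<longlonglongrightarrow> Fin z" using t(2) by (intro tendsto_Fin) (simp add: o_def)
    moreover have "(\<lambda>n. Fin (l ^ r (t n))) \<longlonglongrightarrow> x"
      using LIMSEQ_subseq_LIMSEQ[OF r(2) t(1)] by (simp add: o_def)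
    ultimately have "x = Fin z" using LIMSEQ_unique by blast
    moreover have "strict_mono (\<lambda>n. r (t n))" using r(1) t(1) by (simp add: strict_mono_def)
    ultimately show "x \<in> ?T" using t(2) by (auto simp: o_def)
  qed
qed

section \<open>The recurrence and its two components\<close>

definition solves ::
    "(nat \<Rightarrow> complex) \<Rightarrow> (nat \<Rightarrow> complex) \<Rightarrow> complex \<Rightarrow> complex \<Rightarrow> (nat \<Rightarrow> complex) \<Rightarrow> bool" where
  "solves p q \<alpha> \<beta> X \<longleftrightarrow> (\<forall>n. X (Suc (Suc n)) =
     pert_B p \<alpha> \<beta> (Suc (Suc n)) * X (Suc n) + pert_A q \<alpha> \<beta> (Suc (Suc n)) * X n)"

text \<open>If \<open>\<gamma>\<close> and \<open>\<delta>\<close> are the two roots, a solution \<open>u \<gamma>\<^sup>n + v \<delta>\<^sup>n\<close> of the unperturbed recurrence has the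
constant component \<open>u (\<gamma> - \<delta>) / \<gamma>\<close>.  The case \<open>\<gamma> = \<delta> = \<alpha>\<close> is used as well: it is
the combination that belongs to the root \<open>\<beta>\<close>, measured on the scale of \<open>\<alpha>\<^sup>n\<close>, and it makes sense
even if \<open>\<beta> = 0\<close>.\<close>

definition component :: "complex \<Rightarrow> complex \<Rightarrow> (nat \<Rightarrow> complex) \<Rightarrow> nat \<Rightarrow> complex" where
  "component \<gamma> \<delta> X n = (X (Suc n) - \<delta> * X n) / \<gamma> ^ Suc n"

lemma solves_convergents:
  "solves p q \<alpha> \<beta> (pert_P p q \<alpha> \<beta>)" "solves p q \<alpha> \<beta> (pert_Q p q \<alpha> \<beta>)"
  by (simp_all add: solves_def pert_P_def pert_Q_def)

lemma solves_combination:
  "solves p q \<alpha> \<beta> X \<Longrightarrow> solves p q \<alpha> \<beta> Y \<Longrightarrow> solves p q \<alpha> \<beta> (\<lambda>n. x * X n - y * Y n)"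
  by (simp add: solves_def algebra_simps)

lemma component_combination:
  "component \<gamma> \<delta> (\<lambda>n. x * X n - y * Y n) n = x * component \<gamma> \<delta> X n - y * component \<gamma> \<delta> Y n"
  by (simp add: component_def diff_divide_distrib[symmetric] algebra_simps)

lemma pert_swap:
  "pert_A q \<beta> \<alpha> = pert_A q \<alpha> \<beta>" "pert_B p \<beta> \<alpha> = pert_B p \<alpha> \<beta>"
  "pert_P p q \<beta> \<alpha> = pert_P p q \<alpha> \<beta>" "pert_Q p q \<beta> \<alpha> = pert_Q p q \<alpha> \<beta>"
  "pert_f p q \<beta> \<alpha> = pert_f p q \<alpha> \<beta>"
  "solves p q \<beta> \<alpha> = solves p q \<alpha> \<beta>"
proof -
  show A: "pert_A q \<beta> \<alpha> = pert_A q \<alpha> \<beta>" and B: "pert_B p \<beta> \<alpha> = pert_B p \<alpha> \<beta>"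
    by (simp_all add: fun_eq_iff pert_A_def pert_B_def)
  show "pert_P p q \<beta> \<alpha> = pert_P p q \<alpha> \<beta>" "pert_Q p q \<beta> \<alpha> = pert_Q p q \<alpha> \<beta>"
    "pert_f p q \<beta> \<alpha> = pert_f p q \<alpha> \<beta>" "solves p q \<beta> \<alpha> = solves p q \<alpha> \<beta>"
    by (simp_all add: pert_P_def pert_Q_def pert_f_def solves_def A B fun_eq_iff)
qed

lemma seqs_eq_component:
  "a_seq p q \<alpha> \<beta> = component \<alpha> \<beta> (pert_P p q \<alpha> \<beta>)"
  "b_seq p q \<alpha> \<beta> = component \<beta> \<alpha> (pert_P p q \<alpha> \<beta>)"
  "c_seq p q \<alpha> \<beta> = component \<alpha> \<beta> (pert_Q p q \<alpha> \<beta>)"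
  "d_seq p q \<alpha> \<beta> = component \<beta> \<alpha> (pert_Q p q \<alpha> \<beta>)"
  by (simp_all add: fun_eq_iff a_seq_def b_seq_def c_seq_def d_seq_def component_def)

lemma recover_from_components:
  assumes "\<alpha> \<noteq> 0" "\<beta> \<noteq> 0"
  shows "(\<alpha> - \<beta>) * X n / \<beta> ^ Suc n =
    (\<alpha> / \<beta>) ^ Suc n * component \<alpha> \<beta> X n - component \<beta> \<alpha> X n"
proof -
  have "(\<alpha> / \<beta>) ^ Suc n * component \<alpha> \<beta> X n = (X (Suc n) - \<beta> * X n) / \<beta> ^ Suc n"
    using assms by (simp add: component_def power_divide)
  then show ?thesis
    by (simp add: component_def diff_divide_distrib left_diff_distrib)
qed

section \<open>Convergence of the dominant component\<close>

text \<open>A discrete Gronwall inequality, from \<open>1 + x \<le> exp x\<close>.  It starts from an arbitrary time \<open>N\<close>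
because the perturbations after a late time are to be compared with the state at that time.\<close>

lemma bounded_growth:
  fixes w s :: "nat \<Rightarrow> real"
  assumes step: "\<And>n. w (Suc n) \<le> (1 + 2 * s n) * w n"
    and s: "summable s" "\<And>n. 0 \<le> s n" and w: "\<And>n. 0 \<le> w n"
  shows "w (k + N) \<le> exp (2 * (\<Sum>i. s (i + N))) * w N"
proof -
  have "w (k + N) \<le> exp (2 * (\<Sum>i<k. s (i + N))) * w N"
  proof (induction k)
    case (Suc k)
    have "w (Suc k + N) \<le> (1 + 2 * s (k + N)) * w (k + N)" using step[of "k + N"] by simp
    also have "\<dots> \<le> exp (2 * s (k + N)) * w (k + N)"
      by (intro mult_right_mono exp_ge_add_one_self w)
    also have "\<dots> \<le> exp (2 * s (k + N)) * (exp (2 * (\<Sum>i<k. s (i + N))) * w N)"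
      by (intro mult_left_mono Suc) simp
    finally show ?case by (simp add: exp_add[symmetric] mult.assoc[symmetric] algebra_simps)
  qed simp
  also have "(\<Sum>i<k. s (i + N)) \<le> (\<Sum>i. s (i + N))"
    using s by (intro sum_le_suminf) (auto simp: summable_ignore_initial_segment)
  finally show ?thesis using w by (simp add: mult_right_mono)
qed

text \<open>The factor \<open>M\<close> may depend on \<open>N\<close>; in the application it is a multiple of the state at time \<open>N\<close>.\<close>

lemma limit_of_perturbed_constant:
  fixes U e :: "nat \<Rightarrow> complex" and s :: "nat \<Rightarrow> real"
  assumes step: "\<And>n. U (Suc n) = U n + e n"
    and e: "\<And>k. cmod (e (k + N)) \<le> s (k + N) * M" and s: "summable s"
  shows "convergent U" "cmod (lim U - U N) \<le> (\<Sum>i. s (i + N)) * M"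
proof -
  have sN: "summable (\<lambda>k. s (k + N))" using s by (rule summable_ignore_initial_segment)
  have se: "summable (\<lambda>k. e (k + N))"
    by (rule summable_comparison_test'[OF summable_mult2[OF sN]]) (rule e)
  have shifted: "U (k + N) = U N + (\<Sum>i<k. e (i + N))" for k
    by (induction k) (simp_all add: step algebra_simps)
  have "(\<lambda>k. U (k + N)) \<longlonglongrightarrow> U N + (\<Sum>i. e (i + N))"
    unfolding shifted by (intro tendsto_add tendsto_const summable_LIMSEQ se)
  then have U: "U \<longlonglongrightarrow> U N + (\<Sum>i. e (i + N))" by (rule LIMSEQ_offset)
  then show "convergent U" by (rule convergentI)
  have "cmod (lim U - U N) = cmod (\<Sum>i. e (i + N))" using limI[OF U] by simp
  also have "\<dots> \<le> (\<Sum>i. s (i + N) * M)"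
    using e by (intro norm_suminf_le[OF _ summable_mult2[OF sN]]) auto
  also have "\<dots> = (\<Sum>i. s (i + N)) * M" using sN by (rule suminf_mult2[symmetric])
  finally show "cmod (lim U - U N) \<le> (\<Sum>i. s (i + N)) * M" .
qed

text \<open>Solving the recursion gives the convolution of \<open>e\<close> with a geometric sequence, which is the general
term of a Cauchy product of two absolutely convergent series.\<close>

lemma contraction_null:
  fixes V e :: "nat \<Rightarrow> complex"
  assumes step: "\<And>n. V (Suc n) = \<rho> * V n + e n" and \<rho>: "cmod \<rho> < 1" and e: "summable (\<lambda>n. cmod (e n))"
  shows "V \<longlonglongrightarrow> 0"
proof -
  have V: "V n = \<rho> ^ n * V 0 + (\<Sum>i<n. e i * \<rho> ^ (n - Suc i))" for n
  proof (induction n)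
    case (Suc n)
    have "(\<Sum>i<n. e i * \<rho> ^ (n - i)) = (\<Sum>i<n. \<rho> * (e i * \<rho> ^ (n - Suc i)))"
      by (intro sum.cong) (auto simp: Suc_diff_Suc power_Suc[symmetric] simp del: power_Suc)
    then show ?case by (simp add: step Suc algebra_simps sum_distrib_left)
  qed simp
  have "summable (\<lambda>k. \<Sum>i\<le>k. e i * \<rho> ^ (k - i))"
    by (rule summable_Cauchy_product) (use e \<rho> in \<open>simp_all add: norm_power summable_geometric\<close>)
  then have "(\<lambda>k. \<Sum>i\<le>k. e i * \<rho> ^ (k - i)) \<longlonglongrightarrow> 0" by (rule summable_LIMSEQ_zero)
  moreover have "(\<lambda>n. \<rho> ^ Suc n * V 0) \<longlonglongrightarrow> 0 * V 0"
    by (intro tendsto_intros LIMSEQ_Suc LIMSEQ_power_zero \<rho>)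
  ultimately have "(\<lambda>n. \<rho> ^ Suc n * V 0 + (\<Sum>i\<le>n. e i * \<rho> ^ (n - i))) \<longlonglongrightarrow> 0"
    by (auto intro: tendsto_add_zero)
  then have "(\<lambda>n. V (Suc n)) \<longlonglongrightarrow> 0"
    unfolding V[of "Suc _"] by (simp add: lessThan_Suc_atMost)
  then show ?thesis by (rule LIMSEQ_imp_Suc)
qed

lemma summable_tails:
  assumes "summable (\<lambda>n. cmod (p (Suc n)) + cmod (q (Suc n)))"
  shows "summable (\<lambda>i. cmod (p (n + 1 + i)))" and "summable (\<lambda>i. cmod (q (n + 1 + i)))"
  by (rule summable_comparison_test'[OF summable_ignore_initial_segment[OF assms, of n], of 0];
      simp add: add.commute)+

lemma tail_eps_nonneg:
  assumes "summable (\<lambda>n. cmod (p (Suc n)) + cmod (q (Suc n)))"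
  shows "0 \<le> tail_eps p q n"
  unfolding tail_eps_def
  using suminf_nonneg[OF summable_tails(1)[OF assms, of n]] by (simp add: le_max_iff_disj)

lemma tail_eps_tendsto_0:
  assumes "summable (\<lambda>n. cmod (p (Suc n)) + cmod (q (Suc n)))"
  shows "tail_eps p q \<longlonglongrightarrow> 0"
proof -
  have "(\<lambda>n. \<Sum>i. g (n + 1 + i)) \<longlonglongrightarrow> 0" if g: "summable (\<lambda>i. g (0 + 1 + i))" for g :: "nat \<Rightarrow> real"
  proof -
    have s: "summable (\<lambda>i. g (Suc i))" using g by simp
    have "(\<lambda>n. (\<Sum>i. g (Suc i)) - (\<Sum>i<n. g (Suc i))) \<longlonglongrightarrow> (\<Sum>i. g (Suc i)) - (\<Sum>i. g (Suc i))"
      by (intro tendsto_intros summable_LIMSEQ s)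
    then show ?thesis
      unfolding suminf_minus_initial_segment[OF s, symmetric] by (simp add: add.commute)
  qed
  from tendsto_max[OF this[OF summable_tails(1)[OF assms]] this[OF summable_tails(2)[OF assms]]]
  show ?thesis by (simp add: tail_eps_def[abs_def])
qed

text \<open>Both \<open>|\<beta>| < |\<alpha>|\<close>, where \<open>\<beta> = 0\<close> may occur, and \<open>|\<beta>| = |\<alpha>|\<close> are covered; in the second case the
locale holds with the roots in either order.\<close>

locale dominant_root =
  fixes p q :: "nat \<Rightarrow> complex" and \<alpha> \<beta> :: complex
  assumes summ: "summable (\<lambda>n. cmod (p (Suc n)) + cmod (q (Suc n)))"
    and neq: "\<alpha> \<noteq> \<beta>" and dominant: "cmod \<beta> \<le> cmod \<alpha>"
begin

lemma nonzero: "\<alpha> \<noteq> 0"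
  using neq dominant by auto

text \<open>The constant makes \<open>gain n\<close> bound the defect of one step relative to the size of the two components:
their difference and a combination with coefficients \<open>\<alpha>\<close> and \<open>\<beta>\<close> return \<open>X n\<close> and \<open>X (Suc n)\<close> after
division by \<open>\<alpha> - \<beta>\<close>.\<close>

definition gain :: "nat \<Rightarrow> real" where
  "gain n = (1 + 1 / cmod \<alpha>) / cmod (\<alpha> - \<beta>) *
     (cmod (p (Suc (Suc n))) + cmod (q (Suc (Suc n))))"

definition defect :: "(nat \<Rightarrow> complex) \<Rightarrow> nat \<Rightarrow> complex" where
  "defect X n = (p (Suc (Suc n)) * X (Suc n) + q (Suc (Suc n)) * X n) / \<alpha> ^ Suc (Suc n)"

definition magnitude :: "(nat \<Rightarrow> complex) \<Rightarrow> nat \<Rightarrow> real" where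
  "magnitude X n = cmod (component \<alpha> \<beta> X n) + cmod (component \<alpha> \<alpha> X n)"

lemma gain_nonneg: "0 \<le> gain n"
  by (simp add: gain_def)

lemma summable_gain: "summable gain"
proof -
  have "summable (\<lambda>n. cmod (p (Suc (Suc n))) + cmod (q (Suc (Suc n))))"
    using summ by (subst summable_Suc_iff)
  then show ?thesis unfolding gain_def by (rule summable_mult)
qed

lemma magnitude_nonneg: "0 \<le> magnitude X n"
  by (simp add: magnitude_def)

lemma component_step:
  assumes "solves p q \<alpha> \<beta> X"
  shows "component \<alpha> \<beta> X (Suc n) = component \<alpha> \<beta> X n + defect X n"
    and "component \<alpha> \<alpha> X (Suc n) = \<beta> / \<alpha> * component \<alpha> \<alpha> X n + defect X n"
proof -
  have X: "X (Suc (Suc n)) = (\<alpha> + \<beta> + p (Suc (Suc n))) * X (Suc n)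
      + (- \<alpha> * \<beta> + q (Suc (Suc n))) * X n"
    using assms by (simp add: solves_def pert_A_def pert_B_def)
  have U: "component \<alpha> \<beta> X n = \<alpha> * (X (Suc n) - \<beta> * X n) / \<alpha> ^ Suc (Suc n)"
    and V: "\<beta> / \<alpha> * component \<alpha> \<alpha> X n = \<beta> * (X (Suc n) - \<alpha> * X n) / \<alpha> ^ Suc (Suc n)"
    using nonzero by (simp_all add: component_def)
  have numU: "\<alpha> * (X (Suc n) - \<beta> * X n) + (p (Suc (Suc n)) * X (Suc n) + q (Suc (Suc n)) * X n) =
      X (Suc (Suc n)) - \<beta> * X (Suc n)"
    and numV: "\<beta> * (X (Suc n) - \<alpha> * X n) + (p (Suc (Suc n)) * X (Suc n) + q (Suc (Suc n)) * X n) =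
      X (Suc (Suc n)) - \<alpha> * X (Suc n)"
    unfolding X by (simp_all add: algebra_simps)
  show "component \<alpha> \<beta> X (Suc n) = component \<alpha> \<beta> X n + defect X n"
    unfolding U defect_def add_divide_distrib[symmetric] numU by (simp only: component_def)
  show "component \<alpha> \<alpha> X (Suc n) = \<beta> / \<alpha> * component \<alpha> \<alpha> X n + defect X n"
    unfolding V defect_def add_divide_distrib[symmetric] numV by (simp only: component_def)
qed

lemma defect_bound: "cmod (defect X n) \<le> gain n * magnitude X n"
proof -
  define U V where "U = component \<alpha> \<beta> X n" and "V = component \<alpha> \<alpha> X n"
  define p' q' where "p' = p (Suc (Suc n))" and "q' = q (Suc (Suc n))"
  have pow: "\<alpha> ^ Suc n \<noteq> 0" using nonzero by simp
  have U: "U * \<alpha> ^ Suc n = X (Suc n) - \<beta> * X n" and V: "V * \<alpha> ^ Suc n = X (Suc n) - \<alpha> * X n"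
    using pow by (simp_all add: U_def V_def component_def)
  have x0: "(\<alpha> - \<beta>) * X n = (U - V) * \<alpha> ^ Suc n"
    unfolding left_diff_distrib U V by simp
  have x1: "(\<alpha> - \<beta>) * X (Suc n) = (\<alpha> * U - \<beta> * V) * \<alpha> ^ Suc n"
    unfolding left_diff_distrib mult.assoc U V by (simp add: algebra_simps)
  have "(\<alpha> - \<beta>) * defect X n =
      (p' * ((\<alpha> - \<beta>) * X (Suc n)) + q' * ((\<alpha> - \<beta>) * X n)) / \<alpha> ^ Suc (Suc n)"
    by (simp add: defect_def p'_def q'_def algebra_simps)
  also have "\<dots> = (p' * (\<alpha> * U - \<beta> * V) + q' * (U - V)) * \<alpha> ^ Suc n / (\<alpha> * \<alpha> ^ Suc n)"
    unfolding x0 x1 by (simp add: algebra_simps)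
  also have "\<dots> = (p' * (\<alpha> * U - \<beta> * V) + q' * (U - V)) / \<alpha>"
    using pow by simp
  finally have "cmod (\<alpha> - \<beta>) * cmod (defect X n) =
      cmod (p' * (\<alpha> * U - \<beta> * V) + q' * (U - V)) / cmod \<alpha>"
    by (metis norm_mult norm_divide)
  also have "\<dots> \<le> (cmod p' * (cmod \<alpha> * (cmod U + cmod V)) + cmod q' * (cmod U + cmod V)) / cmod \<alpha>"
  proof (intro divide_right_mono norm_triangle_le add_mono)
    have "cmod (\<alpha> * U - \<beta> * V) \<le> cmod \<alpha> * cmod U + cmod \<beta> * cmod V"
      by (metis norm_mult norm_triangle_ineq4)
    also have "\<dots> \<le> cmod \<alpha> * cmod U + cmod \<alpha> * cmod V"
      using dominant by (intro add_left_mono mult_right_mono) auto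
    finally have "cmod (\<alpha> * U - \<beta> * V) \<le> cmod \<alpha> * (cmod U + cmod V)"
      by (simp add: distrib_left)
    then show "cmod (p' * (\<alpha> * U - \<beta> * V)) \<le> cmod p' * (cmod \<alpha> * (cmod U + cmod V))"
      unfolding norm_mult[of p'] by (rule mult_left_mono) simp
    show "cmod (q' * (U - V)) \<le> cmod q' * (cmod U + cmod V)"
      unfolding norm_mult by (intro mult_left_mono norm_triangle_ineq4) simp
  qed simp
  also have "\<dots> = (cmod p' + cmod q' / cmod \<alpha>) * (cmod U + cmod V)"
    using nonzero by (simp add: add_divide_distrib distrib_right)
  also have "\<dots> \<le> ((1 + 1 / cmod \<alpha>) * (cmod p' + cmod q')) * (cmod U + cmod V)"
    by (intro mult_right_mono) (auto simp: algebra_simps)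
  finally have "cmod (\<alpha> - \<beta>) * cmod (defect X n) \<le>
      ((1 + 1 / cmod \<alpha>) * (cmod p' + cmod q')) * magnitude X n"
    by (simp add: magnitude_def U_def V_def)
  then have "cmod (defect X n) \<le>
      ((1 + 1 / cmod \<alpha>) * (cmod p' + cmod q')) * magnitude X n / cmod (\<alpha> - \<beta>)"
    using neq by (subst pos_le_divide_eq) (simp_all add: mult.commute)
  then show ?thesis by (simp add: gain_def p'_def q'_def)
qed

text \<open>One defect enters each of the two components, whence the factor \<open>2\<close>; \<open>|\<beta>| \<le> |\<alpha>|\<close> is what keeps the
second component from growing on the scale of \<open>\<alpha>\<^sup>n\<close>.\<close>

lemma magnitude_step:
  assumes "solves p q \<alpha> \<beta> X"
  shows "magnitude X (Suc n) \<le> (1 + 2 * gain n) * magnitude X n"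
proof -
  have "cmod (\<beta> / \<alpha>) \<le> 1" using dominant nonzero by (simp add: norm_divide divide_le_eq)
  then have contr: "cmod (\<beta> / \<alpha> * component \<alpha> \<alpha> X n) \<le> cmod (component \<alpha> \<alpha> X n)"
    unfolding norm_mult by (intro mult_left_le_one_le) auto
  have "magnitude X (Suc n) \<le> magnitude X n + 2 * cmod (defect X n)"
    unfolding magnitude_def component_step[OF assms]
    using norm_triangle_ineq[of "component \<alpha> \<beta> X n" "defect X n"]
      norm_triangle_ineq[of "\<beta> / \<alpha> * component \<alpha> \<alpha> X n" "defect X n"] contr
    by linarith
  then show ?thesis using defect_bound[of X n] by (simp add: distrib_right)
qed

lemma magnitude_bound:
  assumes "solves p q \<alpha> \<beta> X"
  shows "magnitude X (k + N) \<le> exp (2 * (\<Sum>i. gain (i + N))) * magnitude X N"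
  by (intro bounded_growth magnitude_step[OF assms] summable_gain gain_nonneg magnitude_nonneg)

text \<open>The increments of the component are the defects, and these are summable as the magnitude stays
bounded.  The bound is relative to the magnitude at time \<open>N\<close>; this makes it possible to conclude,
for large \<open>N\<close>, that a limit is not \<open>0\<close>.\<close>

lemma component_limit:
  assumes "solves p q \<alpha> \<beta> X"
  shows "convergent (component \<alpha> \<beta> X)"
    and "cmod (lim (component \<alpha> \<beta> X) - component \<alpha> \<beta> X N) \<le>
      (\<Sum>i. gain (i + N)) * (exp (2 * (\<Sum>i. gain (i + N))) * magnitude X N)"
proof -
  have e: "cmod (defect X (k + N)) \<le> gain (k + N) * (exp (2 * (\<Sum>i. gain (i + N))) * magnitude X N)"
    for k N
    by (rule order_trans[OF defect_bound mult_left_mono[OF magnitude_bound[OF assms] gain_nonneg]])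
  note * = limit_of_perturbed_constant[OF component_step(1)[OF assms] e summable_gain]
  show "convergent (component \<alpha> \<beta> X)" by (rule *(1))
  show "cmod (lim (component \<alpha> \<beta> X) - component \<alpha> \<beta> X N) \<le>
      (\<Sum>i. gain (i + N)) * (exp (2 * (\<Sum>i. gain (i + N))) * magnitude X N)" by (rule *(2))
qed

lemma subdominant_component_null:
  assumes "solves p q \<alpha> \<beta> X" "cmod \<beta> < cmod \<alpha>"
  shows "component \<alpha> \<alpha> X \<longlonglongrightarrow> 0"
proof (rule contraction_null)
  show "component \<alpha> \<alpha> X (Suc n) = \<beta> / \<alpha> * component \<alpha> \<alpha> X n + defect X n" for n
    by (rule component_step(2)[OF assms(1)])
  show "cmod (\<beta> / \<alpha>) < 1" using assms(2) nonzero by (simp add: norm_divide)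
  have "cmod (defect X k) \<le> gain k * (exp (2 * (\<Sum>i. gain (i + 0))) * magnitude X 0)" for k
    using order_trans[OF defect_bound mult_left_mono[OF magnitude_bound[OF assms(1), of k 0] gain_nonneg]]
    by simp
  then show "summable (\<lambda>n. cmod (defect X n))"
    by (intro summable_comparison_test'[OF summable_mult2[OF summable_gain]]) auto
qed

lemma eventually_small_gain:
  "\<forall>\<^sub>F N in sequentially. 2 * (\<Sum>i. gain (i + N)) * exp (2 * (\<Sum>i. gain (i + N))) < 1"
proof -
  obtain N where N: "\<And>n. n \<ge> N \<Longrightarrow> norm (\<Sum>i. gain (i + n)) < 1 / 8"
    using suminf_exist_split[OF _ summable_gain, of "1 / 8"] by auto
  have "2 * (\<Sum>i. gain (i + n)) * exp (2 * (\<Sum>i. gain (i + n))) < 1" if "n \<ge> N" for n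
  proof -
    define x where "x = (\<Sum>i. gain (i + n))"
    have x: "0 \<le> x" "x < 1 / 8"
      using N[OF that] by (auto simp: x_def intro!: suminf_nonneg gain_nonneg summable_ignore_initial_segment summable_gain)
    \<comment> \<open>The bound \<open>1 / 8\<close> is small enough because \<open>exp 1 \<le> 3 < 4\<close>.\<close>
    have "2 * x * exp (2 * x) \<le> 1 / 4 * exp 1"
      using x by (intro mult_mono) auto
    also have "\<dots> < 1" using exp_le by simp
    finally show ?thesis unfolding x_def .
  qed
  then show ?thesis unfolding eventually_sequentially by blast
qed

lemma gain_tail_le: "(\<Sum>i. gain (i + n)) \<le>
  2 * ((1 + 1 / cmod \<alpha>) / cmod (\<alpha> - \<beta>)) * tail_eps p q n"
proof -
  define C where "C = (1 + 1 / cmod \<alpha>) / cmod (\<alpha> - \<beta>)"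
  have C: "C \<ge> 0" by (simp add: C_def)
  have drop_first: "summable (\<lambda>i. g (Suc (Suc (i + n)))) \<and>
      (\<Sum>i. g (Suc (Suc (i + n)))) \<le> (\<Sum>i. g (n + 1 + i))"
    if s: "summable (\<lambda>i. g (n + 1 + i))" and pos: "\<And>k. 0 \<le> g k" for g :: "nat \<Rightarrow> real"
  proof
    show "summable (\<lambda>i. g (Suc (Suc (i + n))))"
      using s by (subst (asm) summable_Suc_iff[symmetric]) (simp add: add.commute)
    have "(\<Sum>i. g (n + 1 + Suc i)) = (\<Sum>i. g (n + 1 + i)) - g (n + 1 + 0)"
      by (rule suminf_split_head[OF s])
    then show "(\<Sum>i. g (Suc (Suc (i + n)))) \<le> (\<Sum>i. g (n + 1 + i))"
      using pos[of "n + 1"] by (simp add: add.commute)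
  qed
  note tp = drop_first[OF summable_tails(1)[OF summ] norm_ge_zero]
    and tq = drop_first[OF summable_tails(2)[OF summ] norm_ge_zero]
  have "(\<Sum>i. gain (i + n)) =
      C * (\<Sum>i. cmod (p (Suc (Suc (i + n)))) + cmod (q (Suc (Suc (i + n)))))"
    unfolding gain_def C_def[symmetric] using tp tq by (intro suminf_mult summable_add) auto
  also have "\<dots> = C * ((\<Sum>i. cmod (p (Suc (Suc (i + n))))) + (\<Sum>i. cmod (q (Suc (Suc (i + n))))))"
    using tp tq by (subst suminf_add) auto
  also have "\<dots> \<le> C * (tail_eps p q n + tail_eps p q n)"
    using tp tq C by (intro mult_left_mono add_mono) (auto simp: tail_eps_def le_max_iff_disj)
  also have "\<dots> = 2 * C * tail_eps p q n" by simp
  finally show ?thesis unfolding C_def .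
qed

text \<open>In the bound of \<open>component_limit\<close> the exponential and the magnitude are bounded uniformly in the
time, and the tail of the gains is at most a constant times \<open>tail_eps\<close>.\<close>

lemma component_error:
  assumes "solves p q \<alpha> \<beta> X"
  obtains K where "K \<ge> 0"
    "\<And>n. cmod (lim (component \<alpha> \<beta> X) - component \<alpha> \<beta> X n) \<le> K * tail_eps p q n"
proof
  define S C where "S = (\<Sum>i. gain i)" and "C = 2 * ((1 + 1 / cmod \<alpha>) / cmod (\<alpha> - \<beta>))"
  show "C * (exp (2 * S) * (exp (2 * S) * magnitude X 0)) \<ge> 0"
    using magnitude_nonneg by (simp add: C_def)
  fix n
  have pos: "0 \<le> (\<Sum>i. gain (i + n))"
    by (intro suminf_nonneg gain_nonneg summable_ignore_initial_segment summable_gain)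
  have "(\<Sum>i. gain (i + n)) = S - (\<Sum>i<n. gain i)"
    unfolding S_def by (rule suminf_minus_initial_segment[OF summable_gain])
  also have "\<dots> \<le> S" by (simp add: sum_nonneg gain_nonneg)
  finally have le: "(\<Sum>i. gain (i + n)) \<le> S" .
  have magnitude: "magnitude X n \<le> exp (2 * S) * magnitude X 0"
    using magnitude_bound[OF assms, of n 0] by (simp add: S_def)
  have gt: "(\<Sum>i. gain (i + n)) \<le> C * tail_eps p q n"
    unfolding C_def by (rule gain_tail_le)
  have "cmod (lim (component \<alpha> \<beta> X) - component \<alpha> \<beta> X n) \<le>
      (\<Sum>i. gain (i + n)) * (exp (2 * (\<Sum>i. gain (i + n))) * magnitude X n)"
    by (rule component_limit(2)[OF assms])
  also have "\<dots> \<le> (C * tail_eps p q n) * (exp (2 * S) * (exp (2 * S) * magnitude X 0))"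
    using gt pos le by (intro order_trans[OF pos gt] mult_mono magnitude mult_nonneg_nonneg[of "exp _"] magnitude_nonneg[of X n]) auto
  finally show "cmod (lim (component \<alpha> \<beta> X) - component \<alpha> \<beta> X n) \<le>
      C * (exp (2 * S) * (exp (2 * S) * magnitude X 0)) * tail_eps p q n"
    by (simp add: mult_ac)
qed

end

section \<open>The Casoratian of the convergents\<close>

lemma casoratian_step:
  assumes "solves p q \<alpha> \<beta> X" "solves p q \<alpha> \<beta> Y"
  shows "X (Suc (Suc n)) * Y (Suc n) - X (Suc n) * Y (Suc (Suc n)) =
    - pert_A q \<alpha> \<beta> (Suc (Suc n)) * (X (Suc n) * Y n - X n * Y (Suc n))"
  using assms by (simp add: solves_def algebra_simps)

lemma casoratian_convergents:
  "pert_P p q \<alpha> \<beta> (Suc n) * pert_Q p q \<alpha> \<beta> n - pert_P p q \<alpha> \<beta> n * pert_Q p q \<alpha> \<beta> (Suc n) =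
    - (\<Prod>k\<le>n. - pert_A q \<alpha> \<beta> (Suc k))"
proof (induction n)
  case 0
  show ?case by (simp add: pert_P_def pert_Q_def)
next
  case (Suc n)
  show ?case
    unfolding casoratian_step[OF solves_convergents] Suc by simp
qed

lemma casoratian_nonzero:
  assumes "\<And>k. 1 \<le> k \<Longrightarrow> k \<le> Suc n \<Longrightarrow> pert_A q \<alpha> \<beta> k \<noteq> 0"
  shows "pert_P p q \<alpha> \<beta> (Suc n) * pert_Q p q \<alpha> \<beta> n - pert_P p q \<alpha> \<beta> n * pert_Q p q \<alpha> \<beta> (Suc n) \<noteq> 0"
  unfolding casoratian_convergents using assms by (simp add: Suc_le_eq)

text \<open>For \<open>\<eta> = \<delta>\<close> this yields the determinant of the limits; for \<open>\<eta> = \<gamma>\<close> it compares the two components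
that are measured on the same scale.\<close>

lemma component_casoratian:
  "component \<gamma> \<delta> X n * component \<eta> \<gamma> Y n - component \<eta> \<gamma> X n * component \<gamma> \<delta> Y n =
    (\<delta> - \<gamma>) * (X (Suc n) * Y n - X n * Y (Suc n)) / (\<gamma> ^ Suc n * \<eta> ^ Suc n)"
proof -
  have "component \<gamma> \<delta> X n * component \<eta> \<gamma> Y n - component \<eta> \<gamma> X n * component \<gamma> \<delta> Y n =
    ((X (Suc n) - \<delta> * X n) * (Y (Suc n) - \<gamma> * Y n) -
      (X (Suc n) - \<gamma> * X n) * (Y (Suc n) - \<delta> * Y n)) / (\<gamma> ^ Suc n * \<eta> ^ Suc n)"
    unfolding component_def times_divide_times_eq mult.commute[of "\<eta> ^ Suc n" "\<gamma> ^ Suc n"]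
      diff_divide_distrib[symmetric] ..
  also have "(X (Suc n) - \<delta> * X n) * (Y (Suc n) - \<gamma> * Y n) -
      (X (Suc n) - \<gamma> * X n) * (Y (Suc n) - \<delta> * Y n) =
      (\<delta> - \<gamma>) * (X (Suc n) * Y n - X n * Y (Suc n))"
    by (simp add: algebra_simps)
  finally show ?thesis .
qed

section \<open>Roots of different modulus\<close>

lemma approximant_eq_cdiv:
  assumes "(pert_P p q \<alpha> \<beta> n, pert_Q p q \<alpha> \<beta> n) \<noteq> (0, 0)"
  shows "pert_f p q \<alpha> \<beta> n = cdiv (pert_P p q \<alpha> \<beta> n) (pert_Q p q \<alpha> \<beta> n)"
  using assms by (auto simp: pert_f_def cf_approximant_def pert_P_def pert_Q_def)

text \<open>A common factor cancels, and if the limit is not \<open>(0, 0)\<close>, then neither are the pairs \<open>(P n, Q n)\<close> from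
some index on, so that the approximants are true quotients there.\<close>

lemma approximants_tendsto:
  fixes r :: "nat \<Rightarrow> nat"
  assumes x: "(\<lambda>n. k n * pert_P p q \<alpha> \<beta> (r n)) \<longlonglongrightarrow> x"
    and y: "(\<lambda>n. k n * pert_Q p q \<alpha> \<beta> (r n)) \<longlonglongrightarrow> y"
    and nz: "(x, y) \<noteq> (0, 0)" and k: "\<And>n. k n \<noteq> 0"
  shows "(pert_f p q \<alpha> \<beta> \<circ> r) \<longlonglongrightarrow> cdiv x y"
proof -
  have "\<forall>\<^sub>F n in sequentially. (pert_P p q \<alpha> \<beta> (r n), pert_Q p q \<alpha> \<beta> (r n)) \<noteq> (0, 0)"
  proof (cases "x = 0")
    case True
    with nz have "y \<noteq> 0" by simp
    from tendsto_imp_eventually_ne[OF y this] show ?thesis by eventually_elim auto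
  next
    case False
    from tendsto_imp_eventually_ne[OF x this] show ?thesis by eventually_elim auto
  qed
  then have "\<forall>\<^sub>F n in sequentially.
      cdiv (k n * pert_P p q \<alpha> \<beta> (r n)) (k n * pert_Q p q \<alpha> \<beta> (r n)) = (pert_f p q \<alpha> \<beta> \<circ> r) n"
    by eventually_elim (simp add: approximant_eq_cdiv cdiv_scale k)
  then show ?thesis
    by (rule Lim_transform_eventually[OF tendsto_cdiv[OF x y nz]])
qed

context dominant_root
begin

lemma component_limit_tendsto:
  assumes "solves p q \<alpha> \<beta> X"
  shows "component \<alpha> \<beta> X \<longlonglongrightarrow> lim (component \<alpha> \<beta> X)"
  using component_limit(1)[OF assms] by (simp add: convergent_LIMSEQ_iff)

lemma dominant_asymptotics:
  assumes "solves p q \<alpha> \<beta> X" "cmod \<beta> < cmod \<alpha>"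
  shows "(\<lambda>n. (\<alpha> - \<beta>) / \<alpha> ^ Suc n * X n) \<longlonglongrightarrow> lim (component \<alpha> \<beta> X)"
proof -
  have "(\<lambda>n. component \<alpha> \<beta> X n - component \<alpha> \<alpha> X n) \<longlonglongrightarrow> lim (component \<alpha> \<beta> X) - 0"
    by (intro tendsto_diff component_limit_tendsto subdominant_component_null assms)
  moreover have "component \<alpha> \<beta> X n - component \<alpha> \<alpha> X n = (\<alpha> - \<beta>) / \<alpha> ^ Suc n * X n" for n
    by (simp add: component_def diff_divide_distrib[symmetric] left_diff_distrib)
  ultimately show ?thesis by simp
qed

text \<open>Combine \<open>P\<close> and \<open>Q\<close> such that the second component vanishes at a late time \<open>N\<close>.  By the Casoratian
the first component of the combination is then not \<open>0\<close> at time \<open>N\<close>, and it changes afterwards by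
less than its own modulus.\<close>

lemma dominant_limits_nonzero:
  assumes lt: "cmod \<beta> < cmod \<alpha>" and nz: "\<And>k. 1 \<le> k \<Longrightarrow> pert_A q \<alpha> \<beta> k \<noteq> 0"
  shows "(a_lim p q \<alpha> \<beta>, c_lim p q \<alpha> \<beta>) \<noteq> (0, 0)"
proof
  assume zero: "(a_lim p q \<alpha> \<beta>, c_lim p q \<alpha> \<beta>) = (0, 0)"
  define P Q where "P = pert_P p q \<alpha> \<beta>" and "Q = pert_Q p q \<alpha> \<beta>"
  have solves: "solves p q \<alpha> \<beta> P" "solves p q \<alpha> \<beta> Q"
    unfolding P_def Q_def by (rule solves_convergents)+
  obtain N where N: "2 * (\<Sum>i. gain (i + N)) * exp (2 * (\<Sum>i. gain (i + N))) < 1"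
    using eventually_small_gain by (auto simp: eventually_sequentially)
  \<comment> \<open>The coefficients are chosen such that the second component of \<open>X\<close> cancels at \<open>N\<close>.\<close>
  define X where "X = (\<lambda>n. component \<alpha> \<alpha> Q N * P n - component \<alpha> \<alpha> P N * Q n)"
  have X: "solves p q \<alpha> \<beta> X"
    unfolding X_def by (intro solves_combination solves)
  have V: "component \<alpha> \<alpha> X N = 0"
    unfolding X_def component_combination by simp
  have "component \<alpha> \<beta> X N = component \<alpha> \<beta> P N * component \<alpha> \<alpha> Q N - component \<alpha> \<alpha> P N * component \<alpha> \<beta> Q N"
    unfolding X_def component_combination by simp
  also have "\<dots> = (\<beta> - \<alpha>) * (P (Suc N) * Q N - P N * Q (Suc N)) / (\<alpha> ^ Suc N * \<alpha> ^ Suc N)"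
    by (rule component_casoratian)
  also have "\<dots> \<noteq> 0"
    using neq nonzero casoratian_nonzero[of N q \<alpha> \<beta> p] nz by (simp add: P_def Q_def)
  finally have U: "component \<alpha> \<beta> X N \<noteq> 0" .
  have "component \<alpha> \<beta> X \<longlonglongrightarrow>
      component \<alpha> \<alpha> Q N * a_lim p q \<alpha> \<beta> - component \<alpha> \<alpha> P N * c_lim p q \<alpha> \<beta>"
    unfolding X_def component_combination a_lim_def c_lim_def seqs_eq_component P_def[symmetric] Q_def[symmetric]
    by (intro tendsto_intros component_limit_tendsto solves)
  with zero have "lim (component \<alpha> \<beta> X) = 0" by (simp add: limI)
  with component_limit(2)[OF X, of N]
  have "cmod (component \<alpha> \<beta> X N) \<le>
      (\<Sum>i. gain (i + N)) * exp (2 * (\<Sum>i. gain (i + N))) * cmod (component \<alpha> \<beta> X N)"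
    by (simp add: magnitude_def V mult.assoc)
  also have "\<dots> < 1 * cmod (component \<alpha> \<beta> X N)"
  proof (rule mult_strict_right_mono)
    have "0 \<le> (\<Sum>i. gain (i + N)) * exp (2 * (\<Sum>i. gain (i + N)))"
      by (intro mult_nonneg_nonneg suminf_nonneg gain_nonneg summable_ignore_initial_segment summable_gain) simp
    then show "(\<Sum>i. gain (i + N)) * exp (2 * (\<Sum>i. gain (i + N))) < 1" using N by linarith
  qed (use U in simp)
  finally show False by simp
qed

lemma dominant_closure:
  assumes lt: "cmod \<beta> < cmod \<alpha>" and nz: "(a_lim p q \<alpha> \<beta>, c_lim p q \<alpha> \<beta>) \<noteq> (0, 0)"
  shows "seq_closure (pert_f p q \<alpha> \<beta>) = {cdiv (a_lim p q \<alpha> \<beta>) (c_lim p q \<alpha> \<beta>)}"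
proof (rule seq_closure_convergent)
  have "(pert_f p q \<alpha> \<beta> \<circ> (\<lambda>n. n)) \<longlonglongrightarrow> cdiv (a_lim p q \<alpha> \<beta>) (c_lim p q \<alpha> \<beta>)"
    using dominant_asymptotics[OF solves_convergents(1) lt]
      dominant_asymptotics[OF solves_convergents(2) lt] nz
    unfolding a_lim_def c_lim_def seqs_eq_component
    by (rule approximants_tendsto) (use neq nonzero in simp)
  then show "pert_f p q \<alpha> \<beta> \<longlonglongrightarrow> cdiv (a_lim p q \<alpha> \<beta>) (c_lim p q \<alpha> \<beta>)"
    by (simp add: o_def)
qed

end

section \<open>A vanishing partial numerator\<close>

text \<open>Running the recurrence backwards carries zeros down to \<open>Q 0 = 1\<close>.  The step down fails at a
vanishing partial numerator; but there the Casoratian, a product of the earlier partial numerators,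
is not \<open>0\<close>, so the zeros cannot have come so far.\<close>

lemma convergents_not_consecutively_zero:
  assumes one: "\<And>m n. 1 \<le> m \<Longrightarrow> 1 \<le> n \<Longrightarrow>
      pert_A q \<alpha> \<beta> m = 0 \<Longrightarrow> pert_A q \<alpha> \<beta> n = 0 \<Longrightarrow> m = n"
  shows "\<not> (pert_P p q \<alpha> \<beta> n = 0 \<and> pert_Q p q \<alpha> \<beta> n = 0 \<and>
    pert_P p q \<alpha> \<beta> (Suc n) = 0 \<and> pert_Q p q \<alpha> \<beta> (Suc n) = 0)"
proof (induction n)
  case 0
  show ?case by (simp add: pert_Q_def)
next
  case (Suc n)
  show ?case
  proof
    assume *: "pert_P p q \<alpha> \<beta> (Suc n) = 0 \<and> pert_Q p q \<alpha> \<beta> (Suc n) = 0 \<and>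
      pert_P p q \<alpha> \<beta> (Suc (Suc n)) = 0 \<and> pert_Q p q \<alpha> \<beta> (Suc (Suc n)) = 0"
    show False
    proof (cases "pert_A q \<alpha> \<beta> (Suc (Suc n)) = 0")
      case True
      have "pert_A q \<alpha> \<beta> k \<noteq> 0" if "1 \<le> k" "k \<le> Suc n" for k
        using one[of k "Suc (Suc n)"] True that by auto
      from casoratian_nonzero[OF this, of n p] * show False by simp
    next
      case False
      with * have "pert_P p q \<alpha> \<beta> n = 0 \<and> pert_Q p q \<alpha> \<beta> n = 0"
        using solves_convergents[of p q \<alpha> \<beta>] by (auto simp: solves_def)
      with Suc * show False by simp
    qed
  qed
qed

text \<open>From index \<open>N - 1\<close> on, \<open>P\<close> and \<open>Q\<close> are multiples of one and the same solution of the recurrence, so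
that \<open>(P n, Q n)\<close> is proportional to \<open>(P (N - 1), Q (N - 1))\<close>.\<close>

lemma finite_fraction_eventually_constant:
  assumes one: "\<And>m n. 1 \<le> m \<Longrightarrow> 1 \<le> n \<Longrightarrow>
      pert_A q \<alpha> \<beta> m = 0 \<Longrightarrow> pert_A q \<alpha> \<beta> n = 0 \<Longrightarrow> m = n"
    and N: "1 \<le> N" "pert_A q \<alpha> \<beta> N = 0"
  shows "\<exists>L. \<forall>n\<ge>N. pert_f p q \<alpha> \<beta> n = L"
proof -
  define P Q where "P = pert_P p q \<alpha> \<beta>" and "Q = pert_Q p q \<alpha> \<beta>"
  obtain M where M: "N = Suc M" using N(1) by (cases N) auto
  have nz: "(P M, Q M) \<noteq> (0, 0)"
  proof (cases M)
    case 0
    then show ?thesis by (simp add: Q_def pert_Q_def)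
  next
    case (Suc K)
    have "pert_A q \<alpha> \<beta> k \<noteq> 0" if "1 \<le> k" "k \<le> Suc K" for k
      using one[of k N] N that M Suc by auto
    from casoratian_nonzero[OF this, of K p] show ?thesis
      by (auto simp: P_def Q_def Suc)
  qed
  have proportional: "P (M + k) * Q M = P M * Q (M + k) \<and> P (Suc M + k) * Q M = P M * Q (Suc M + k)" for k
  proof (induction k)
    case 0
    have "P (Suc M) = pert_B p \<alpha> \<beta> (Suc M) * P M \<and> Q (Suc M) = pert_B p \<alpha> \<beta> (Suc M) * Q M"
      using N(2) M by (cases M) (simp_all add: P_def Q_def pert_P_def pert_Q_def)
    then show ?case by simp
  next
    case (Suc k)
    have "P (Suc (Suc (M + k))) * Q M = P M * Q (Suc (Suc (M + k)))"
    proof -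
      have "P (Suc (Suc (M + k))) * Q M =
          pert_B p \<alpha> \<beta> (Suc (Suc (M + k))) * (P (Suc (M + k)) * Q M)
          + pert_A q \<alpha> \<beta> (Suc (Suc (M + k))) * (P (M + k) * Q M)"
        using solves_convergents(1)[of p q \<alpha> \<beta>] by (simp add: solves_def P_def algebra_simps)
      also have "\<dots> = pert_B p \<alpha> \<beta> (Suc (Suc (M + k))) * (P M * Q (Suc (M + k)))
          + pert_A q \<alpha> \<beta> (Suc (Suc (M + k))) * (P M * Q (M + k))"
        using Suc by simp
      also have "\<dots> = P M * Q (Suc (Suc (M + k)))"
        using solves_convergents(2)[of p q \<alpha> \<beta>] by (simp add: solves_def Q_def algebra_simps)
      finally show ?thesis .
    qed
    with Suc show ?case by simp
  qed
  have least: "(LEAST N. 1 \<le> N \<and> pert_A q \<alpha> \<beta> N = 0) = N"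
  proof (rule Least_equality)
    show "N \<le> y" if "1 \<le> y \<and> pert_A q \<alpha> \<beta> y = 0" for y
      using one[of N y] that N by simp
  qed (use N in simp)
  have "pert_f p q \<alpha> \<beta> n = cdiv (P M) (Q M)" if "n \<ge> N" for n
  proof (cases "P n = 0 \<and> Q n = 0")
    case True
    then have "pert_f p q \<alpha> \<beta> n = cdiv (P (N - 1)) (Q (N - 1))"
      unfolding P_def Q_def pert_P_def pert_Q_def pert_f_def cf_approximant_def Let_def least
      by (rule if_P)
    then show ?thesis by (simp add: M)
  next
    case False
    have "P n * Q M = P M * Q n"
      using proportional[of "n - M"] that M by simp
    with False nz have "cdiv (P n) (Q n) = cdiv (P M) (Q M)"
      by (intro cdiv_eqI) auto
    then show ?thesis using approximant_eq_cdiv[of p q \<alpha> \<beta> n] False by (simp add: P_def Q_def)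
  qed
  then show ?thesis by blast
qed

section \<open>Roots of equal modulus\<close>

lemma quotient_error:
  fixes x y X Y :: complex
  assumes \<delta>: "0 < \<delta>" "\<delta> \<le> cmod Y" "\<delta> / 2 \<le> cmod y"
    and X: "cmod X \<le> B" and e: "cmod (x - X) \<le> e" "cmod (y - Y) \<le> e"
  shows "cmod (x / y - X / Y) \<le> (2 / \<delta> + 2 * B / \<delta>\<^sup>2) * e"
proof -
  have nz: "Y \<noteq> 0" "y \<noteq> 0" using \<delta> by auto
  have e0: "0 \<le> e" using e(1) norm_ge_zero order_trans by blast
  have B0: "0 \<le> B" using X norm_ge_zero order_trans by blast
  have "x / y - X / Y = (x - X) / y + X * (Y - y) / (y * Y)"
    using nz by (simp add: field_simps)
  then have "cmod (x / y - X / Y) \<le>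
      cmod (x - X) / cmod y + cmod X * cmod (y - Y) / (cmod y * cmod Y)"
    by (metis norm_triangle_ineq norm_divide norm_mult norm_minus_commute)
  also have "\<dots> \<le> e / (\<delta> / 2) + B * e / (\<delta> / 2 * \<delta>)"
    using \<delta> X e e0 B0 by (intro add_mono frac_le mult_mono mult_nonneg_nonneg mult_pos_pos) auto
  also have "\<dots> = (2 / \<delta> + 2 * B / \<delta>\<^sup>2) * e"
    by (simp add: field_simps power2_eq_square)
  finally show ?thesis .
qed

locale equal_moduli =
  fixes p q :: "nat \<Rightarrow> complex" and \<alpha> \<beta> :: complex
  assumes summ: "summable (\<lambda>n. cmod (p (Suc n)) + cmod (q (Suc n)))"
    and neq: "\<alpha> \<noteq> \<beta>" and equal: "cmod \<alpha> = cmod \<beta>"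

sublocale equal_moduli \<subseteq> \<alpha>: dominant_root p q \<alpha> \<beta>
  using summ neq equal by unfold_locales auto

sublocale equal_moduli \<subseteq> \<beta>: dominant_root p q \<beta> \<alpha>
  using summ neq equal by unfold_locales auto

context equal_moduli
begin

abbreviation (input) \<rho> where "\<rho> \<equiv> \<alpha> / \<beta>"
abbreviation (input) a where "a \<equiv> a_lim p q \<alpha> \<beta>"
abbreviation (input) b where "b \<equiv> b_lim p q \<alpha> \<beta>"
abbreviation (input) c where "c \<equiv> c_lim p q \<alpha> \<beta>"
abbreviation (input) d where "d \<equiv> d_lim p q \<alpha> \<beta>"

lemma norm_ratio_power: "cmod (\<rho> ^ n) = 1"
  using equal \<beta>.nonzero by (simp add: norm_power norm_divide)

lemma components_tendsto:
  assumes "solves p q \<alpha> \<beta> X"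
  shows "component \<alpha> \<beta> X \<longlonglongrightarrow> lim (component \<alpha> \<beta> X)"
    and "component \<beta> \<alpha> X \<longlonglongrightarrow> lim (component \<beta> \<alpha> X)"
  using \<alpha>.component_limit_tendsto[OF assms] \<beta>.component_limit_tendsto[of X] assms
  by (simp_all add: pert_swap(6)[of p q \<beta> \<alpha>])

lemma convergents_components_tendsto:
  shows "component \<alpha> \<beta> (pert_P p q \<alpha> \<beta>) \<longlonglongrightarrow> a"
    and "component \<beta> \<alpha> (pert_P p q \<alpha> \<beta>) \<longlonglongrightarrow> - b"
    and "component \<alpha> \<beta> (pert_Q p q \<alpha> \<beta>) \<longlonglongrightarrow> c"
    and "component \<beta> \<alpha> (pert_Q p q \<alpha> \<beta>) \<longlonglongrightarrow> - d"
  using components_tendsto[OF solves_convergents(1)] components_tendsto[OF solves_convergents(2)]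
  by (simp_all add: a_lim_def b_lim_def c_lim_def d_lim_def seqs_eq_component)

text \<open>A solution is recovered from its two components; the normalisation by \<open>\<beta>\<^sup>n\<^sup>+\<^sup>1\<close> turns \<open>\<alpha>\<^sup>n\<^sup>+\<^sup>1\<close> into
\<open>\<rho>\<^sup>n\<^sup>+\<^sup>1\<close>, which has modulus one.\<close>

lemma normalised_error:
  assumes X: "solves p q \<alpha> \<beta> X"
  obtains K where "K \<ge> 0" "\<And>n. cmod ((\<alpha> - \<beta>) / \<beta> ^ Suc n * X n -
    (lim (component \<alpha> \<beta> X) * \<rho> ^ Suc n - lim (component \<beta> \<alpha> X))) \<le> K * tail_eps p q n"
proof -
  have X': "solves p q \<beta> \<alpha> X" using X by (simp add: pert_swap(6)[of p q \<beta> \<alpha>])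
  obtain K where K: "K \<ge> 0"
      "\<And>n. cmod (lim (component \<alpha> \<beta> X) - component \<alpha> \<beta> X n) \<le> K * tail_eps p q n"
    using \<alpha>.component_error[OF X] by blast
  obtain L where L: "L \<ge> 0"
      "\<And>n. cmod (lim (component \<beta> \<alpha> X) - component \<beta> \<alpha> X n) \<le> L * tail_eps p q n"
    using \<beta>.component_error[OF X'] by blast
  have "cmod ((\<alpha> - \<beta>) / \<beta> ^ Suc n * X n -
    (lim (component \<alpha> \<beta> X) * \<rho> ^ Suc n - lim (component \<beta> \<alpha> X))) \<le> (K + L) * tail_eps p q n" for n
  proof -
    have "(\<alpha> - \<beta>) / \<beta> ^ Suc n * X n - (lim (component \<alpha> \<beta> X) * \<rho> ^ Suc n - lim (component \<beta> \<alpha> X))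
      = (lim (component \<beta> \<alpha> X) - component \<beta> \<alpha> X n)
        - \<rho> ^ Suc n * (lim (component \<alpha> \<beta> X) - component \<alpha> \<beta> X n)"
      using recover_from_components[OF \<alpha>.nonzero \<beta>.nonzero, of X n]
      by (simp add: algebra_simps del: power_Suc)
    also have "cmod \<dots> \<le> cmod (lim (component \<beta> \<alpha> X) - component \<beta> \<alpha> X n)
        + cmod (\<rho> ^ Suc n) * cmod (lim (component \<alpha> \<beta> X) - component \<alpha> \<beta> X n)"
      unfolding norm_mult[symmetric] by (rule norm_triangle_ineq4)
    also have "\<dots> \<le> L * tail_eps p q n + K * tail_eps p q n"
      unfolding norm_ratio_power using K(2)[of n] L(2)[of n] by simp
    finally show ?thesis by (simp add: distrib_right)
  qed
  with K(1) L(1) show ?thesis by (intro that[of "K + L"]) auto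
qed

lemma convergents_error:
  obtains K where "K \<ge> 0"
    "\<And>n. cmod ((\<alpha> - \<beta>) / \<beta> ^ Suc n * pert_P p q \<alpha> \<beta> n - (a * \<rho> ^ Suc n + b)) \<le> K * tail_eps p q n"
    "\<And>n. cmod ((\<alpha> - \<beta>) / \<beta> ^ Suc n * pert_Q p q \<alpha> \<beta> n - (c * \<rho> ^ Suc n + d)) \<le> K * tail_eps p q n"
proof -
  obtain K where K: "K \<ge> 0"
    "\<And>n. cmod ((\<alpha> - \<beta>) / \<beta> ^ Suc n * pert_P p q \<alpha> \<beta> n - (a * \<rho> ^ Suc n + b)) \<le> K * tail_eps p q n"
    using normalised_error[OF solves_convergents(1)]
    by (auto simp: a_lim_def b_lim_def seqs_eq_component)
  obtain L where L: "L \<ge> 0"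
    "\<And>n. cmod ((\<alpha> - \<beta>) / \<beta> ^ Suc n * pert_Q p q \<alpha> \<beta> n - (c * \<rho> ^ Suc n + d)) \<le> L * tail_eps p q n"
    using normalised_error[OF solves_convergents(2)]
    by (auto simp: c_lim_def d_lim_def seqs_eq_component)
  have "0 \<le> tail_eps p q n" for n by (rule tail_eps_nonneg[OF summ])
  then have le: "K * tail_eps p q n \<le> max K L * tail_eps p q n"
      "L * tail_eps p q n \<le> max K L * tail_eps p q n" for n
    by (auto intro: mult_right_mono)
  show ?thesis
    using K(1) by (intro that[of "max K L"] order_trans[OF K(2) le(1)] order_trans[OF L(2) le(2)]) simp
qed

text \<open>At a late time the two components differ from their limits by less than half of their total
modulus.  If both limits are \<open>0\<close>, both components must be \<open>0\<close>.\<close>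

lemma solution_with_null_components_vanishes:
  assumes X: "solves p q \<alpha> \<beta> X"
    and lims: "lim (component \<alpha> \<beta> X) = 0" "lim (component \<beta> \<alpha> X) = 0"
  shows "\<forall>\<^sub>F N in sequentially. X N = 0 \<and> X (Suc N) = 0"
  using \<alpha>.eventually_small_gain
proof eventually_elim
  case (elim N)
  have X': "solves p q \<beta> \<alpha> X" using X by (simp add: pert_swap(6)[of p q \<beta> \<alpha>])
  \<comment> \<open>Exchanging the roots changes neither the gains nor the magnitude, as \<open>|\<alpha>| = |\<beta>|\<close>.\<close>
  have gain: "\<beta>.gain = \<alpha>.gain"
    by (simp add: fun_eq_iff \<beta>.gain_def \<alpha>.gain_def equal norm_minus_commute)
  have same: "cmod (component \<alpha> \<alpha> X N) = cmod (component \<beta> \<alpha> X N)"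
      "cmod (component \<beta> \<beta> X N) = cmod (component \<alpha> \<beta> X N)"
    by (simp_all add: component_def norm_divide norm_mult norm_power equal)
  define m t where "m = \<alpha>.magnitude X N" and "t = (\<Sum>i. \<alpha>.gain (i + N))"
  have m: "\<beta>.magnitude X N = m"
    by (simp add: m_def \<alpha>.magnitude_def \<beta>.magnitude_def same)
  have "cmod (component \<alpha> \<beta> X N) \<le> t * (exp (2 * t) * m)"
    using \<alpha>.component_limit(2)[OF X, of N] lims(1) by (simp add: m_def t_def)
  moreover have "cmod (component \<beta> \<alpha> X N) \<le> t * (exp (2 * t) * m)"
    using \<beta>.component_limit(2)[OF X', of N] lims(2) m by (simp add: t_def gain)
  ultimately have le: "m \<le> (2 * t * exp (2 * t)) * m"
    by (simp add: m_def \<alpha>.magnitude_def same)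
  have lt: "2 * t * exp (2 * t) < 1" using elim by (simp add: t_def)
  have "\<not> 0 < m"
    using mult_strict_right_mono[OF lt, of m] le by auto
  then have "m = 0"
    using \<alpha>.magnitude_nonneg[of X N] by (simp add: m_def)
  then have "component \<alpha> \<beta> X N = 0" "component \<alpha> \<alpha> X N = 0"
    by (simp_all add: m_def \<alpha>.magnitude_def add_nonneg_eq_0_iff)
  then have "X (Suc N) = \<beta> * X N" "X (Suc N) = \<alpha> * X N"
    using \<alpha>.nonzero by (simp_all add: component_def)
  then show ?case using neq by auto
qed

lemma limits_not_all_zero:
  assumes one: "\<And>m n. 1 \<le> m \<Longrightarrow> 1 \<le> n \<Longrightarrow>
      pert_A q \<alpha> \<beta> m = 0 \<Longrightarrow> pert_A q \<alpha> \<beta> n = 0 \<Longrightarrow> m = n"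
  shows "\<not> (a = 0 \<and> b = 0 \<and> c = 0 \<and> d = 0)"
proof
  assume zero: "a = 0 \<and> b = 0 \<and> c = 0 \<and> d = 0"
  have "\<forall>\<^sub>F N in sequentially. pert_P p q \<alpha> \<beta> N = 0 \<and> pert_P p q \<alpha> \<beta> (Suc N) = 0"
    using zero
    by (intro solution_with_null_components_vanishes solves_convergents)
      (simp_all add: a_lim_def b_lim_def seqs_eq_component)
  moreover have "\<forall>\<^sub>F N in sequentially. pert_Q p q \<alpha> \<beta> N = 0 \<and> pert_Q p q \<alpha> \<beta> (Suc N) = 0"
    using zero
    by (intro solution_with_null_components_vanishes solves_convergents)
      (simp_all add: c_lim_def d_lim_def seqs_eq_component)
  ultimately obtain N where "pert_P p q \<alpha> \<beta> N = 0 \<and> pert_P p q \<alpha> \<beta> (Suc N) = 0"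
      "pert_Q p q \<alpha> \<beta> N = 0 \<and> pert_Q p q \<alpha> \<beta> (Suc N) = 0"
    using eventually_happens'[OF sequentially_bot eventually_conj] by blast
  then show False using convergents_not_consecutively_zero[of q \<alpha> \<beta> p, OF one] by blast
qed

text \<open>The components of \<open>P\<close> and \<open>Q\<close> tend to \<open>a\<close>, \<open>-b\<close>, \<open>c\<close>, \<open>-d\<close>, and the determinant formed from them is
the Casoratian on the scale of \<open>(\<alpha> \<beta>)\<^sup>n\<close>.\<close>

lemma determinant:
  shows "convergent_prod (\<lambda>n. 1 - q (Suc n) / (\<alpha> * \<beta>))"
    and "a * d - b * c = (\<beta> - \<alpha>) * (\<Prod>n. 1 - q (Suc n) / (\<alpha> * \<beta>))"
proof -
  have nz: "\<alpha> * \<beta> \<noteq> 0" using \<alpha>.nonzero \<beta>.nonzero by simp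
  have "summable (\<lambda>n. cmod (q (Suc n)))"
    using summable_tails(2)[OF summ, of 0] by simp
  then have "summable (\<lambda>n. cmod (q (Suc n)) / cmod (\<alpha> * \<beta>))" by (rule summable_divide)
  then show prod: "convergent_prod (\<lambda>n. 1 - q (Suc n) / (\<alpha> * \<beta>))"
    by (intro abs_convergent_prod_imp_convergent_prod summable_imp_abs_convergent_prod)
      (simp add: norm_divide)
  let ?P = "pert_P p q \<alpha> \<beta>" and ?Q = "pert_Q p q \<alpha> \<beta>"
  have "(\<lambda>n. component \<alpha> \<beta> ?P n * component \<beta> \<alpha> ?Q n - component \<beta> \<alpha> ?P n * component \<alpha> \<beta> ?Q n)
      \<longlonglongrightarrow> a * (- d) - (- b) * c"
    by (intro tendsto_intros convergents_components_tendsto)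
  moreover have "component \<alpha> \<beta> ?P n * component \<beta> \<alpha> ?Q n - component \<beta> \<alpha> ?P n * component \<alpha> \<beta> ?Q n =
      - ((\<beta> - \<alpha>) * (\<Prod>k\<le>n. 1 - q (Suc k) / (\<alpha> * \<beta>)))" for n
  proof -
    have "(\<Prod>k\<le>n. 1 - q (Suc k) / (\<alpha> * \<beta>)) = (\<Prod>k\<le>n. - pert_A q \<alpha> \<beta> (Suc k) / (\<alpha> * \<beta>))"
      using nz by (intro prod.cong) (auto simp: pert_A_def field_simps)
    also have "\<dots> = (\<Prod>k\<le>n. - pert_A q \<alpha> \<beta> (Suc k)) / (\<alpha> ^ Suc n * \<beta> ^ Suc n)"
      unfolding prod_dividef prod_constant power_mult_distrib[symmetric] by simp
    finally show ?thesis
      unfolding component_casoratian casoratian_convergents by simp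
  qed
  ultimately have "(\<lambda>n. - ((\<beta> - \<alpha>) * (\<Prod>k\<le>n. 1 - q (Suc k) / (\<alpha> * \<beta>)))) \<longlonglongrightarrow> - (a * d - b * c)"
    by simp
  moreover have "(\<lambda>n. - ((\<beta> - \<alpha>) * (\<Prod>k\<le>n. 1 - q (Suc k) / (\<alpha> * \<beta>)))) \<longlonglongrightarrow>
      - ((\<beta> - \<alpha>) * (\<Prod>n. 1 - q (Suc n) / (\<alpha> * \<beta>)))"
    by (intro tendsto_intros convergent_prod_LIMSEQ prod)
  ultimately have "- (a * d - b * c) = - ((\<beta> - \<alpha>) * (\<Prod>n. 1 - q (Suc n) / (\<alpha> * \<beta>)))"
    by (rule LIMSEQ_unique)
  then show "a * d - b * c = (\<beta> - \<alpha>) * (\<Prod>n. 1 - q (Suc n) / (\<alpha> * \<beta>))"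
    by (simp only: neg_equal_iff_equal)
qed

text \<open>Eliminating the numerator and the denominator from each other leaves \<open>(a d - b c) z\<close>, and the
infinite product for the determinant has no vanishing factor.\<close>

lemma no_indeterminacy:
  assumes A: "\<And>n. 1 \<le> n \<Longrightarrow> pert_A q \<alpha> \<beta> n \<noteq> 0" and z: "z \<noteq> 0"
  shows "(a * z + b, c * z + d) \<noteq> (0, 0)"
proof
  assume "(a * z + b, c * z + d) = (0, 0)"
  then have zero: "a * z + b = 0" "c * z + d = 0" by auto
  have "(a * d - b * c) * z = d * (a * z + b) - b * (c * z + d)" by (simp add: algebra_simps)
  with zero z have "a * d - b * c = 0" by simp
  moreover have "(\<Prod>n. 1 - q (Suc n) / (\<alpha> * \<beta>)) \<noteq> 0"
  proof (rule prodinf_nonzero[OF determinant(1)])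
    show "1 - q (Suc n) / (\<alpha> * \<beta>) \<noteq> 0" for n
      using A[of "Suc n"] \<alpha>.nonzero \<beta>.nonzero by (auto simp: pert_A_def)
  qed
  ultimately show False using determinant(2) neq by simp
qed

lemma approximants_along_subsequence:
  fixes r :: "nat \<Rightarrow> nat"
  assumes r: "strict_mono r" and z: "(\<lambda>n. \<rho> ^ Suc (r n)) \<longlonglongrightarrow> z"
    and nz: "(a * z + b, c * z + d) \<noteq> (0, 0)"
  shows "(pert_f p q \<alpha> \<beta> \<circ> r) \<longlonglongrightarrow> cdiv (a * z + b) (c * z + d)"
proof (rule approximants_tendsto[OF _ _ nz])
  note sub = convergents_components_tendsto[THEN LIMSEQ_subseq_LIMSEQ, OF r, unfolded o_def]
  have eq: "(\<alpha> - \<beta>) / \<beta> ^ Suc (r n) * X (r n) =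
      component \<alpha> \<beta> X (r n) * \<rho> ^ Suc (r n) - component \<beta> \<alpha> X (r n)" for X n
    using recover_from_components[OF \<alpha>.nonzero \<beta>.nonzero, of X "r n"]
    by (simp add: mult.commute del: power_Suc)
  have "(\<lambda>n. (\<alpha> - \<beta>) / \<beta> ^ Suc (r n) * pert_P p q \<alpha> \<beta> (r n)) \<longlonglongrightarrow> a * z - (- b)"
    unfolding eq by (intro tendsto_diff tendsto_mult sub z)
  then show "(\<lambda>n. (\<alpha> - \<beta>) / \<beta> ^ Suc (r n) * pert_P p q \<alpha> \<beta> (r n)) \<longlonglongrightarrow> a * z + b" by simp
  have "(\<lambda>n. (\<alpha> - \<beta>) / \<beta> ^ Suc (r n) * pert_Q p q \<alpha> \<beta> (r n)) \<longlonglongrightarrow> c * z - (- d)"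
    unfolding eq by (intro tendsto_diff tendsto_mult sub z)
  then show "(\<lambda>n. (\<alpha> - \<beta>) / \<beta> ^ Suc (r n) * pert_Q p q \<alpha> \<beta> (r n)) \<longlonglongrightarrow> c * z + d" by simp
  show "(\<alpha> - \<beta>) / \<beta> ^ Suc (r n) \<noteq> 0" for n using neq \<beta>.nonzero by simp
qed

text \<open>Compactness of the unit circle: each sequence of indices has a refinement along which the powers of
\<open>\<rho>\<close> converge, and then the approximants converge as well.\<close>

lemma convergent_refinement:
  fixes r :: "nat \<Rightarrow> nat"
  assumes A: "\<And>n. 1 \<le> n \<Longrightarrow> pert_A q \<alpha> \<beta> n \<noteq> 0" and r: "strict_mono r"
  obtains z and t :: "nat \<Rightarrow> nat" where "strict_mono t" "strict_mono (\<lambda>n. r (t n))"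
    "(\<lambda>n. \<rho> ^ Suc (r (t n))) \<longlonglongrightarrow> z" "(a * z + b, c * z + d) \<noteq> (0, 0)"
    "(\<lambda>n. pert_f p q \<alpha> \<beta> (r (t n))) \<longlonglongrightarrow> cdiv (a * z + b) (c * z + d)"
proof -
  obtain z and t :: "nat \<Rightarrow> nat"
    where z: "cmod z = 1" and t: "strict_mono t" "((\<lambda>n. \<rho> ^ Suc (r n)) \<circ> t) \<longlonglongrightarrow> z"
    by (rule unimodular_convergent_subsequence[of "\<lambda>n. \<rho> ^ Suc (r n)"]) (rule norm_ratio_power)
  have conv: "(\<lambda>n. \<rho> ^ Suc (r (t n))) \<longlonglongrightarrow> z" using t(2) by (simp add: o_def)
  have nz: "(a * z + b, c * z + d) \<noteq> (0, 0)" by (rule no_indeterminacy[OF A]) (use z in auto)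
  have rt: "strict_mono (\<lambda>n. r (t n))" using r t(1) by (simp add: strict_mono_def)
  have f: "(\<lambda>n. pert_f p q \<alpha> \<beta> (r (t n))) \<longlonglongrightarrow> cdiv (a * z + b) (c * z + d)"
    using approximants_along_subsequence[OF rt conv nz] by (simp add: o_def)
  show ?thesis by (rule that[OF t(1) rt conv nz f])
qed

lemma asymptotic_to_linear_fractional:
  assumes A: "\<And>n. 1 \<le> n \<Longrightarrow> pert_A q \<alpha> \<beta> n \<noteq> 0"
  shows "asymptotic (pert_f p q \<alpha> \<beta>) (\<lambda>n. lin_frac a b c d (Fin (\<rho> ^ (n + 1))))"
  unfolding asymptotic_def
proof (rule tendsto_zero_by_subsequences)
  fix r :: "nat \<Rightarrow> nat" assume r: "strict_mono r"
  obtain z and t :: "nat \<Rightarrow> nat" where t: "strict_mono t" and rt: "strict_mono (\<lambda>n. r (t n))"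
    and conv: "(\<lambda>n. \<rho> ^ Suc (r (t n))) \<longlonglongrightarrow> z" and nz: "(a * z + b, c * z + d) \<noteq> (0, 0)"
    and f: "(\<lambda>n. pert_f p q \<alpha> \<beta> (r (t n))) \<longlonglongrightarrow> cdiv (a * z + b) (c * z + d)"
    by (rule convergent_refinement[OF A r]; assumption?)
  have "(\<lambda>n. lin_frac a b c d (Fin (\<rho> ^ (r (t n) + 1)))) \<longlonglongrightarrow> cdiv (a * z + b) (c * z + d)"
    unfolding lin_frac_def lin_at.simps Suc_eq_plus1[symmetric]
    by (intro tendsto_cdiv tendsto_add tendsto_mult tendsto_const conv nz)
  with f have "(\<lambda>n. dist (pert_f p q \<alpha> \<beta> (r (t n))) (lin_frac a b c d (Fin (\<rho> ^ (r (t n) + 1)))))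
      \<longlonglongrightarrow> dist (cdiv (a * z + b) (c * z + d)) (cdiv (a * z + b) (c * z + d))"
    by (rule tendsto_dist)
  with t show "\<exists>t :: nat \<Rightarrow> nat. strict_mono t \<and>
      (\<lambda>n. dist (pert_f p q \<alpha> \<beta> (r (t n))) (lin_frac a b c d (Fin (\<rho> ^ (r (t n) + 1))))) \<longlonglongrightarrow> 0"
    by auto
qed

lemma power_limit_set_ratio:
  "power_limit_set (cdiv \<alpha> \<beta>) =
    {Fin z | z. \<exists>r::nat \<Rightarrow> nat. strict_mono r \<and> (\<lambda>n. \<rho> ^ r n) \<longlonglongrightarrow> z}"
  using power_limit_set_unimodular[of \<rho>] norm_ratio_power[of 1] \<beta>.nonzero by (simp add: cdiv_def)

text \<open>The approximant with index \<open>n\<close> corresponds to \<open>\<rho> ^ (n + 1)\<close>, so that an exponent \<open>r n\<close> has to be lowered by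
one; dropping the first term of the subsequence keeps the exponents positive.\<close>

lemma linear_fractional_set_subset_closure:
  "lin_frac_set a b c d (power_limit_set (cdiv \<alpha> \<beta>)) \<subseteq> seq_closure (pert_f p q \<alpha> \<beta>)"
proof
  fix l assume "l \<in> lin_frac_set a b c d (power_limit_set (cdiv \<alpha> \<beta>))"
  then obtain z and r :: "nat \<Rightarrow> nat" where l: "l = cdiv (a * z + b) (c * z + d)"
    and nz: "(a * z + b, c * z + d) \<noteq> (0, 0)" and r: "strict_mono r" "(\<lambda>n. \<rho> ^ r n) \<longlonglongrightarrow> z"
    by (auto simp: lin_frac_set_def power_limit_set_ratio lin_frac_def)
  have pos: "0 < r (Suc n)" for n
    using strict_mono_imp_increasing[OF r(1), of "Suc n"] by simp
  have "strict_mono (\<lambda>n. r (Suc n) - 1)"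
    using r(1) pos by (auto simp: strict_mono_def intro!: diff_less_mono simp: Suc_le_eq)
  moreover have "(\<lambda>n. \<rho> ^ Suc (r (Suc n) - 1)) \<longlonglongrightarrow> z"
    using LIMSEQ_Suc[OF r(2)] pos by simp
  ultimately show "l \<in> seq_closure (pert_f p q \<alpha> \<beta>)"
    using approximants_along_subsequence[OF _ _ nz] unfolding seq_closure_def l by blast
qed

lemma closure_subset_linear_fractional_set:
  assumes A: "\<And>n. 1 \<le> n \<Longrightarrow> pert_A q \<alpha> \<beta> n \<noteq> 0"
  shows "seq_closure (pert_f p q \<alpha> \<beta>) \<subseteq> lin_frac_set a b c d (power_limit_set (cdiv \<alpha> \<beta>))"
proof
  fix l assume "l \<in> seq_closure (pert_f p q \<alpha> \<beta>)"
  then obtain r :: "nat \<Rightarrow> nat" where r: "strict_mono r" "(pert_f p q \<alpha> \<beta> \<circ> r) \<longlonglongrightarrow> l"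
    unfolding seq_closure_def by blast
  obtain z and t :: "nat \<Rightarrow> nat" where t: "strict_mono t" and rt: "strict_mono (\<lambda>n. r (t n))"
    and conv: "(\<lambda>n. \<rho> ^ Suc (r (t n))) \<longlonglongrightarrow> z" and nz: "(a * z + b, c * z + d) \<noteq> (0, 0)"
    and f: "(\<lambda>n. pert_f p q \<alpha> \<beta> (r (t n))) \<longlonglongrightarrow> cdiv (a * z + b) (c * z + d)"
    by (rule convergent_refinement[OF A r(1)]; assumption?)
  have "(\<lambda>n. pert_f p q \<alpha> \<beta> (r (t n))) \<longlonglongrightarrow> l"
    using LIMSEQ_subseq_LIMSEQ[OF r(2) t] by (simp add: o_def)
  then have l: "l = cdiv (a * z + b) (c * z + d)" using f by (rule LIMSEQ_unique)
  have "strict_mono (\<lambda>n. Suc (r (t n)))" using rt by (simp add: strict_mono_def)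
  then have "Fin z \<in> power_limit_set (cdiv \<alpha> \<beta>)"
    unfolding power_limit_set_ratio using conv by blast
  then show "l \<in> lin_frac_set a b c d (power_limit_set (cdiv \<alpha> \<beta>))"
    using nz by (auto simp: lin_frac_set_def lin_frac_def l intro!: exI[of _ "Fin z"])
qed

text \<open>With \<open>z\<close> also \<open>\<rho> z\<close>, a different point, is a limit of powers of \<open>\<rho>\<close>.  If the fraction were \<open>0 / 0\<close> at
two points, all four limits would be \<open>0\<close>, and \<open>P\<close> and \<open>Q\<close> would vanish from some index on.\<close>

lemma linear_fractional_set_nonempty:
  assumes one: "\<And>m n. 1 \<le> m \<Longrightarrow> 1 \<le> n \<Longrightarrow>
      pert_A q \<alpha> \<beta> m = 0 \<Longrightarrow> pert_A q \<alpha> \<beta> n = 0 \<Longrightarrow> m = n"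
  shows "lin_frac_set a b c d (power_limit_set (cdiv \<alpha> \<beta>)) \<noteq> {}"
proof
  assume empty: "lin_frac_set a b c d (power_limit_set (cdiv \<alpha> \<beta>)) = {}"
  have zero: "a * w + b = 0 \<and> c * w + d = 0" if "Fin w \<in> power_limit_set (cdiv \<alpha> \<beta>)" for w
    using empty that by (force simp: lin_frac_set_def)
  obtain z and r :: "nat \<Rightarrow> nat"
    where z: "cmod z = 1" and r: "strict_mono r" "((\<lambda>n. \<rho> ^ n) \<circ> r) \<longlonglongrightarrow> z"
    by (rule unimodular_convergent_subsequence[of "\<lambda>n. \<rho> ^ n"]) (rule norm_ratio_power)
  have r2: "(\<lambda>n. \<rho> ^ r n) \<longlonglongrightarrow> z" using r(2) by (simp add: o_def)
  have z1: "Fin z \<in> power_limit_set (cdiv \<alpha> \<beta>)"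
    unfolding power_limit_set_ratio using r(1) r2 by blast
  have "(\<lambda>n. \<rho> ^ Suc (r n)) \<longlonglongrightarrow> \<rho> * z"
    unfolding power_Suc by (intro tendsto_mult tendsto_const r2)
  moreover have "strict_mono (\<lambda>n. Suc (r n))" using r(1) by (simp add: strict_mono_def)
  ultimately have z2: "Fin (\<rho> * z) \<in> power_limit_set (cdiv \<alpha> \<beta>)"
    unfolding power_limit_set_ratio by blast
  have ne: "\<rho> * z \<noteq> z" 
  proof -
    have "\<rho> \<noteq> 1" "z \<noteq> 0" using z neq \<beta>.nonzero by auto
    then show ?thesis unfolding mult_cancel_right2 by blast
  qed
  have "u = 0 \<and> v = 0" if "u * z + v = 0" "u * (\<rho> * z) + v = 0" for u v
  proof -
    have "u * (\<rho> * z - z) = (u * (\<rho> * z) + v) - (u * z + v)" by (simp add: algebra_simps)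
    then have "u * (\<rho> * z - z) = 0" unfolding that by simp
    then have "u = 0" using ne by simp
    then show ?thesis using that by simp
  qed
  from this[of a b] this[of c d] zero[OF z1] zero[OF z2]
  show False using limits_not_all_zero[OF one] by blast
qed

text \<open>If a partial numerator vanishes, the closure is a single point; it contains the nonempty set on
the right-hand side.\<close>

lemma closure_eq:
  assumes one: "\<And>m n. 1 \<le> m \<Longrightarrow> 1 \<le> n \<Longrightarrow>
      pert_A q \<alpha> \<beta> m = 0 \<Longrightarrow> pert_A q \<alpha> \<beta> n = 0 \<Longrightarrow> m = n"
  shows "seq_closure (pert_f p q \<alpha> \<beta>) = lin_frac_set a b c d (power_limit_set (cdiv \<alpha> \<beta>))"
proof (cases "\<forall>n\<ge>1. pert_A q \<alpha> \<beta> n \<noteq> 0")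
  case True
  then show ?thesis
    using closure_subset_linear_fractional_set linear_fractional_set_subset_closure by blast
next
  case False
  then obtain N where "1 \<le> N" "pert_A q \<alpha> \<beta> N = 0" by blast
  then obtain L where L: "\<And>n. n \<ge> N \<Longrightarrow> pert_f p q \<alpha> \<beta> n = L"
    using finite_fraction_eventually_constant[of q \<alpha> \<beta> N p, OF one] by blast
  have "pert_f p q \<alpha> \<beta> \<longlonglongrightarrow> L"
    using L by (intro tendsto_eventually) (auto simp: eventually_sequentially)
  then have "seq_closure (pert_f p q \<alpha> \<beta>) = {L}" by (rule seq_closure_convergent)
  moreover have "lin_frac_set a b c d (power_limit_set (cdiv \<alpha> \<beta>)) \<noteq> {}"
    by (rule linear_fractional_set_nonempty) (rule one)
  ultimately show ?thesis
    using linear_fractional_set_subset_closure by (metis subset_singletonD)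
qed

text \<open>For a root of unity \<open>\<rho>\<close> the denominator takes only the values at exponents below its order.\<close>

lemma denominator_bounded_below:
  assumes "cmod c \<noteq> cmod d \<or> (\<exists>m. primitive_root_of_unity m \<rho> \<and> (\<forall>n<m. c * \<alpha> ^ n + d * \<beta> ^ n \<noteq> 0))"
  obtains \<delta> where "\<delta> > 0" "\<And>n. \<delta> \<le> cmod (c * \<rho> ^ n + d)"
  using assms
proof (elim disjE exE conjE)
  assume ne: "cmod c \<noteq> cmod d"
  have "\<bar>cmod c - cmod d\<bar> \<le> cmod (c * \<rho> ^ n + d)" for n
    using norm_triangle_ineq3[of "c * \<rho> ^ n" "- d"] by (simp only: norm_mult norm_ratio_power) simp
  then show ?thesis using ne by (intro that[of "\<bar>cmod c - cmod d\<bar>"]) auto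
next
  fix m assume m: "primitive_root_of_unity m \<rho>" and nz: "\<forall>n<m. c * \<alpha> ^ n + d * \<beta> ^ n \<noteq> 0"
  have pos: "0 < m" and pow: "\<rho> ^ m = 1" using m by (auto simp: primitive_root_of_unity_def)
  define \<delta> where "\<delta> = Min ((\<lambda>n. cmod (c * \<rho> ^ n + d)) ` {..<m})"
  have "c * \<rho> ^ n + d \<noteq> 0" if "n < m" for n
  proof
    assume "c * \<rho> ^ n + d = 0"
    then have "\<beta> ^ n * (c * \<rho> ^ n + d) = 0" by simp
    then show False using nz that \<beta>.nonzero by (simp add: power_divide distrib_left mult.commute)
  qed
  then have "0 < \<delta>"
    unfolding \<delta>_def using pos by (subst Min_gr_iff) (auto simp: lessThan_empty_iff)
  moreover have "\<delta> \<le> cmod (c * \<rho> ^ n + d)" for n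
  proof -
    have "\<rho> ^ n = \<rho> ^ (m * (n div m) + n mod m)" by simp
    also have "\<dots> = \<rho> ^ (n mod m)" unfolding power_add power_mult pow by simp
    finally have mod: "\<rho> ^ n = \<rho> ^ (n mod m)" .
    show ?thesis unfolding \<delta>_def mod using pos by (intro Min_le) auto
  qed
  ultimately show ?thesis by (rule that)
qed

text \<open>Both convergents, normalised, have errors of order \<open>tail_eps\<close>; as the denominator of the linear
fraction stays away from \<open>0\<close>, so eventually does the normalised \<open>Q n\<close>, and the quotients have an
error of the same order.\<close>

lemma approximant_error:
  assumes \<delta>: "\<delta> > 0" "\<And>n. \<delta> \<le> cmod (c * \<rho> ^ n + d)"
  defines "h \<equiv> lin_frac a b c d"
  shows "\<forall>\<^sub>F n in sequentially. pert_f p q \<alpha> \<beta> n \<noteq> Infty \<and> h (Fin (\<rho> ^ (n + 1))) \<noteq> Infty"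
    and "(\<lambda>n. cmod (the_fin (pert_f p q \<alpha> \<beta> n) - the_fin (h (Fin (\<rho> ^ (n + 1)))))) \<in> O(tail_eps p q)"
proof -
  define k where "k n = (\<alpha> - \<beta>) / \<beta> ^ Suc n" for n
  define x y where "x n = k n * pert_P p q \<alpha> \<beta> n" and "y n = k n * pert_Q p q \<alpha> \<beta> n" for n
  define X Y where "X n = a * \<rho> ^ Suc n + b" and "Y n = c * \<rho> ^ Suc n + d" for n
  have k: "k n \<noteq> 0" for n using neq \<beta>.nonzero by (simp add: k_def)
  obtain K where K: "K \<ge> 0" "\<And>n. cmod (x n - X n) \<le> K * tail_eps p q n"
      "\<And>n. cmod (y n - Y n) \<le> K * tail_eps p q n"
    using convergents_error unfolding x_def y_def X_def Y_def k_def by blast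
  have Y: "\<delta> \<le> cmod (Y n)" for n unfolding Y_def by (rule \<delta>(2))
  have X: "cmod (X n) \<le> cmod a + cmod b" for n
    using norm_triangle_ineq[of "a * \<rho> ^ Suc n" b] unfolding X_def norm_mult norm_ratio_power by simp
  have "(\<lambda>n. K * tail_eps p q n) \<longlonglongrightarrow> K * 0"
    by (intro tendsto_intros tail_eps_tendsto_0 summ)
  then have "\<forall>\<^sub>F n in sequentially. K * tail_eps p q n < \<delta> / 2"
    using \<delta>(1) by (intro order_tendstoD(2)[of _ "K * 0"]) auto
  then have big: "\<forall>\<^sub>F n in sequentially. \<delta> / 2 \<le> cmod (y n)"
  proof eventually_elim
    case (elim n)
    have "cmod (Y n) \<le> cmod (y n) + cmod (y n - Y n)"
      using norm_triangle_ineq4[of "y n" "y n - Y n"] by simp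
    then show ?case using Y[of n] K(3)[of n] elim by linarith
  qed
  have h: "h (Fin (\<rho> ^ (n + 1))) = Fin (X n / Y n)" for n
    using Y[of n] \<delta>(1) by (auto simp: h_def lin_frac_def cdiv_def X_def Y_def)
  have f: "pert_f p q \<alpha> \<beta> n = Fin (x n / y n)" if "\<delta> / 2 \<le> cmod (y n)" for n
  proof -
    have "y n \<noteq> 0" using that \<delta>(1) by auto
    then have "pert_Q p q \<alpha> \<beta> n \<noteq> 0" by (auto simp: y_def)
    then show ?thesis
      using approximant_eq_cdiv[of p q \<alpha> \<beta> n] k[of n] by (simp add: cdiv_def x_def y_def)
  qed
  show "\<forall>\<^sub>F n in sequentially. pert_f p q \<alpha> \<beta> n \<noteq> Infty \<and> h (Fin (\<rho> ^ (n + 1))) \<noteq> Infty"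
    using big by eventually_elim (simp only: f h sphere.simps simp_thms not_False_eq_True)
  define B where "B = 2 / \<delta> + 2 * (cmod a + cmod b) / \<delta>\<^sup>2"
  show "(\<lambda>n. cmod (the_fin (pert_f p q \<alpha> \<beta> n) - the_fin (h (Fin (\<rho> ^ (n + 1)))))) \<in> O(tail_eps p q)"
  proof (rule bigoI[of _ "B * K"])
    show "\<forall>\<^sub>F n in sequentially. norm (cmod (the_fin (pert_f p q \<alpha> \<beta> n) - the_fin (h (Fin (\<rho> ^ (n + 1)))))) \<le>
        B * K * norm (tail_eps p q n)"
      using big
    proof eventually_elim
      case (elim n)
      have "cmod (x n / y n - X n / Y n) \<le> B * (K * tail_eps p q n)"
        unfolding B_def by (rule quotient_error[OF \<delta>(1) Y elim X K(2,3)])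
      then show ?case
        using tail_eps_nonneg[OF summ, of n] by (simp only: f[OF elim] h sphere.sel) (simp add: mult.assoc)
    qed
  qed
qed

lemma convergents_error_unimodular:
  assumes "cmod \<alpha> = 1"
  shows "(\<lambda>n. cmod (pert_P p q \<alpha> \<beta> n - (a * \<alpha> ^ (n + 1) + b * \<beta> ^ (n + 1)) / (\<alpha> - \<beta>))) \<in> O(tail_eps p q)"
    and "(\<lambda>n. cmod (pert_Q p q \<alpha> \<beta> n - (c * \<alpha> ^ (n + 1) + d * \<beta> ^ (n + 1)) / (\<alpha> - \<beta>))) \<in> O(tail_eps p q)"
proof -
  have unscale: "cmod (w - (u * \<alpha> ^ (n + 1) + v * \<beta> ^ (n + 1)) / (\<alpha> - \<beta>)) =
      cmod ((\<alpha> - \<beta>) / \<beta> ^ Suc n * w - (u * \<rho> ^ Suc n + v)) / cmod (\<alpha> - \<beta>)" for u v w n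
  proof -
    have "\<beta> ^ Suc n * ((\<alpha> - \<beta>) / \<beta> ^ Suc n * w - (u * \<rho> ^ Suc n + v)) =
        (\<alpha> - \<beta>) * w - (u * \<alpha> ^ (n + 1) + v * \<beta> ^ (n + 1))"
    proof -
      have "B * (x / B * w - (u * (A / B) + v)) = x * w - (u * A + v * B)" if "B \<noteq> 0" for x A B
        using that by (simp add: field_simps)
      from this[of "\<beta> ^ Suc n"] \<beta>.nonzero show ?thesis
        unfolding power_divide Suc_eq_plus1[symmetric] by simp
    qed
    then have "w - (u * \<alpha> ^ (n + 1) + v * \<beta> ^ (n + 1)) / (\<alpha> - \<beta>) =
        \<beta> ^ Suc n * ((\<alpha> - \<beta>) / \<beta> ^ Suc n * w - (u * \<rho> ^ Suc n + v)) / (\<alpha> - \<beta>)"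
      using neq by (simp only: diff_divide_distrib) simp
    then show ?thesis using assms equal by (simp add: norm_divide norm_mult norm_power)
  qed
  obtain K where K: "K \<ge> 0"
    "\<And>n. cmod ((\<alpha> - \<beta>) / \<beta> ^ Suc n * pert_P p q \<alpha> \<beta> n - (a * \<rho> ^ Suc n + b)) \<le> K * tail_eps p q n"
    "\<And>n. cmod ((\<alpha> - \<beta>) / \<beta> ^ Suc n * pert_Q p q \<alpha> \<beta> n - (c * \<rho> ^ Suc n + d)) \<le> K * tail_eps p q n"
    using convergents_error by blast
  have O: "(\<lambda>n. g n / cmod (\<alpha> - \<beta>)) \<in> O(tail_eps p q)"
    if "\<And>n. 0 \<le> g n" "\<And>n. g n \<le> K * tail_eps p q n" for g
  proof (rule bigoI[of _ "K / cmod (\<alpha> - \<beta>)"], intro always_eventually allI)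
    show "norm (g n / cmod (\<alpha> - \<beta>)) \<le> K / cmod (\<alpha> - \<beta>) * norm (tail_eps p q n)" for n
      using that[of n] tail_eps_nonneg[OF summ, of n] by (simp add: divide_right_mono)
  qed
  show "(\<lambda>n. cmod (pert_P p q \<alpha> \<beta> n - (a * \<alpha> ^ (n + 1) + b * \<beta> ^ (n + 1)) / (\<alpha> - \<beta>))) \<in> O(tail_eps p q)"
    unfolding unscale by (rule O[OF norm_ge_zero K(2)])
  show "(\<lambda>n. cmod (pert_Q p q \<alpha> \<beta> n - (c * \<alpha> ^ (n + 1) + d * \<beta> ^ (n + 1)) / (\<alpha> - \<beta>))) \<in> O(tail_eps p q)"
    unfolding unscale by (rule O[OF norm_ge_zero K(3)])
qed

end

section \<open>All pairs of distinct roots\<close>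

lemma limits_swap:
  "b_lim p q \<alpha> \<beta> = - a_lim p q \<beta> \<alpha>" "d_lim p q \<alpha> \<beta> = - c_lim p q \<beta> \<alpha>"
  by (simp_all add: a_lim_def b_lim_def c_lim_def d_lim_def seqs_eq_component
      pert_swap(3,4)[of p q \<beta> \<alpha>])

theorem theorem7:
  fixes p q :: "nat \<Rightarrow> complex" and \<alpha> \<beta> a b c d :: complex
    and P Q :: "nat \<Rightarrow> complex" and f :: "nat \<Rightarrow> sphere" and \<epsilon> :: "nat \<Rightarrow> real"
    and h :: "sphere \<Rightarrow> sphere"
  assumes summ: "summable (\<lambda>n. cmod (p (Suc n)) + cmod (q (Suc n)))"
    and neq: "\<alpha> \<noteq> \<beta>"
    and one_zero: "\<And>m n. 1 \<le> m \<Longrightarrow> 1 \<le> n \<Longrightarrow>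
          pert_A q \<alpha> \<beta> m = 0 \<Longrightarrow> pert_A q \<alpha> \<beta> n = 0 \<Longrightarrow> m = n"
    and nondeg: "\<And>n. 1 \<le> n \<Longrightarrow> (pert_A q \<alpha> \<beta> n, pert_B p \<alpha> \<beta> n) \<noteq> (0, 0)"
  defines "P \<equiv> pert_P p q \<alpha> \<beta>" and "Q \<equiv> pert_Q p q \<alpha> \<beta>" and "f \<equiv> pert_f p q \<alpha> \<beta>"
    and "\<epsilon> \<equiv> tail_eps p q"
    and "a \<equiv> a_lim p q \<alpha> \<beta>" and "b \<equiv> b_lim p q \<alpha> \<beta>"
    and "c \<equiv> c_lim p q \<alpha> \<beta>" and "d \<equiv> d_lim p q \<alpha> \<beta>"
    and "h \<equiv> lin_frac a b c d"
  shows
    "(cmod \<alpha> = cmod \<beta> \<and> cmod \<alpha> \<noteq> 0 \<longrightarrow>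
        convergent (a_seq p q \<alpha> \<beta>) \<and> convergent (b_seq p q \<alpha> \<beta>) \<and>
        convergent (c_seq p q \<alpha> \<beta>) \<and> convergent (d_seq p q \<alpha> \<beta>) \<and>
        b = - a_lim p q \<beta> \<alpha> \<and> d = - c_lim p q \<beta> \<alpha>) \<and>
     (cmod \<alpha> > cmod \<beta> \<longrightarrow> convergent (a_seq p q \<alpha> \<beta>) \<and> convergent (c_seq p q \<alpha> \<beta>)) \<and>
     (cmod \<alpha> < cmod \<beta> \<longrightarrow> convergent (b_seq p q \<alpha> \<beta>) \<and> convergent (d_seq p q \<alpha> \<beta>)) \<and>
     \<comment> \<open>For a finite continued fraction with \<open>|\<alpha>| \<noteq> |\<beta>|\<close> the single value \<open>a / c\<close> or \<open>b / d\<close> may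
        be \<open>0 / 0\<close>; the limit set formula has a meaning only if it is not.\<close>
     ((\<forall>n\<ge>1. pert_A q \<alpha> \<beta> n \<noteq> 0) \<or> cmod \<alpha> = cmod \<beta> \<or>
        lin_frac_set a b c d (power_limit_set (cdiv \<alpha> \<beta>)) \<noteq> {} \<longrightarrow>
        seq_closure f = lin_frac_set a b c d (power_limit_set (cdiv \<alpha> \<beta>))) \<and>
     (cmod \<alpha> = cmod \<beta> \<and> cmod \<alpha> \<noteq> 0 \<and> (\<forall>n\<ge>1. q n \<noteq> \<alpha> * \<beta>) \<longrightarrow>
        asymptotic f (\<lambda>n. h (Fin ((\<alpha> / \<beta>) ^ (n + 1)))) \<and>
        convergent_prod (\<lambda>n. 1 - q (Suc n) / (\<alpha> * \<beta>)) \<and>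
        a * d - b * c = (\<beta> - \<alpha>) * (\<Prod>n. 1 - q (Suc n) / (\<alpha> * \<beta>))) \<and>
     (cmod \<alpha> = cmod \<beta> \<and> cmod \<alpha> \<noteq> 0 \<and>
        (cmod c \<noteq> cmod d \<or>
         cmod c = cmod d \<and>
           (\<exists>m. primitive_root_of_unity m (\<alpha> / \<beta>) \<and> (\<forall>n<m. c * \<alpha> ^ n + d * \<beta> ^ n \<noteq> 0))) \<longrightarrow>
        (\<forall>\<^sub>F n in sequentially. f n \<noteq> Infty \<and> h (Fin ((\<alpha> / \<beta>) ^ (n + 1))) \<noteq> Infty) \<and>
        (\<lambda>n. cmod (the_fin (f n) - the_fin (h (Fin ((\<alpha> / \<beta>) ^ (n + 1)))))) \<in> O(\<epsilon>)) \<and>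
     (cmod \<alpha> = 1 \<and> cmod \<beta> = 1 \<longrightarrow>
        (\<lambda>n. cmod (P n - (a * \<alpha> ^ (n + 1) + b * \<beta> ^ (n + 1)) / (\<alpha> - \<beta>))) \<in> O(\<epsilon>) \<and>
        (\<lambda>n. cmod (Q n - (c * \<alpha> ^ (n + 1) + d * \<beta> ^ (n + 1)) / (\<alpha> - \<beta>))) \<in> O(\<epsilon>))"
proof -
  have E: "equal_moduli p q \<alpha> \<beta>" if "cmod \<alpha> = cmod \<beta>"
    using summ neq that by unfold_locales
  have D: "dominant_root p q \<alpha> \<beta>" if "cmod \<beta> < cmod \<alpha>"
    using summ neq that by unfold_locales auto
  have D': "dominant_root p q \<beta> \<alpha>" if "cmod \<alpha> < cmod \<beta>"
    using summ neq that by unfold_locales auto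
  have solves: "solves p q \<beta> \<alpha> (pert_P p q \<alpha> \<beta>)" "solves p q \<beta> \<alpha> (pert_Q p q \<alpha> \<beta>)"
    by (simp_all add: pert_swap(6)[of p q \<beta> \<alpha>] solves_convergents)
  have \<alpha>_limits: "convergent (a_seq p q \<alpha> \<beta>)" "convergent (c_seq p q \<alpha> \<beta>)"
    if "dominant_root p q \<alpha> \<beta>"
    unfolding seqs_eq_component
    by (intro dominant_root.component_limit(1)[OF that] solves_convergents)+
  have \<beta>_limits: "convergent (b_seq p q \<alpha> \<beta>)" "convergent (d_seq p q \<alpha> \<beta>)"
    if "dominant_root p q \<beta> \<alpha>"
    unfolding seqs_eq_component
    by (intro dominant_root.component_limit(1)[OF that] solves)+
  have closure: "seq_closure f = lin_frac_set a b c d (power_limit_set (cdiv \<alpha> \<beta>))"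
    if hyp: "(\<forall>n\<ge>1. pert_A q \<alpha> \<beta> n \<noteq> 0) \<or> cmod \<alpha> = cmod \<beta> \<or>
        lin_frac_set a b c d (power_limit_set (cdiv \<alpha> \<beta>)) \<noteq> {}"
  proof -
    consider "cmod \<alpha> = cmod \<beta>" | "cmod \<beta> < cmod \<alpha>" | "cmod \<alpha> < cmod \<beta>" by linarith
    then show ?thesis
    proof cases
      case 1
      show ?thesis
        unfolding f_def a_def b_def c_def d_def
        by (rule equal_moduli.closure_eq[OF E[OF 1]]) (rule one_zero)
    next
      case 2
      have set: "lin_frac_set a b c d (power_limit_set (cdiv \<alpha> \<beta>)) =
          (if (a, c) \<noteq> (0, 0) then {cdiv a c} else {})"
        unfolding power_limit_set_gt_1[OF 2] by (auto simp: lin_frac_set_def lin_frac_def)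
      have nz: "(a, c) \<noteq> (0, 0)"
      proof (cases "\<forall>n\<ge>1. pert_A q \<alpha> \<beta> n \<noteq> 0")
        case True
        then show ?thesis
          unfolding a_def c_def by (intro dominant_root.dominant_limits_nonzero[OF D[OF 2] 2]) simp
      next
        case False
        with hyp 2 show ?thesis unfolding set by (auto split: if_splits)
      qed
      show ?thesis
        using dominant_root.dominant_closure[OF D[OF 2] 2] nz
        unfolding set f_def by (simp add: a_def c_def)
    next
      case 3
      have set: "lin_frac_set a b c d (power_limit_set (cdiv \<alpha> \<beta>)) =
          (if (b, d) \<noteq> (0, 0) then {cdiv b d} else {})"
        unfolding power_limit_set_lt_1[OF 3] by (auto simp: lin_frac_set_def lin_frac_def)
      have bd: "a_lim p q \<beta> \<alpha> = - b" "c_lim p q \<beta> \<alpha> = - d"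
        unfolding b_def d_def limits_swap by simp_all
      have nz: "(b, d) \<noteq> (0, 0)"
      proof (cases "\<forall>n\<ge>1. pert_A q \<alpha> \<beta> n \<noteq> 0")
        case True
        then have "(- b, - d) \<noteq> (0, 0)"
          unfolding bd[symmetric]
          by (intro dominant_root.dominant_limits_nonzero[OF D'[OF 3] 3])
            (simp add: pert_swap(1)[of q \<beta> \<alpha>])
        then show ?thesis by simp
      next
        case False
        with hyp 3 show ?thesis unfolding set by (auto split: if_splits)
      qed
      have "cdiv (- b) (- d) = cdiv b d" using cdiv_scale[of "-1" b d] by simp
      then show ?thesis
        using dominant_root.dominant_closure[OF D'[OF 3] 3] nz
        unfolding set f_def by (simp add: bd pert_swap(5)[of p q \<beta> \<alpha>])
    qed
  qed
  have nonzero: "pert_A q \<alpha> \<beta> n \<noteq> 0" if "\<forall>n\<ge>1. q n \<noteq> \<alpha> * \<beta>" "1 \<le> n" for n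
    using that by (auto simp: pert_A_def)
  have rate: "(\<forall>\<^sub>F n in sequentially. f n \<noteq> Infty \<and> h (Fin ((\<alpha> / \<beta>) ^ (n + 1))) \<noteq> Infty) \<and>
      (\<lambda>n. cmod (the_fin (f n) - the_fin (h (Fin ((\<alpha> / \<beta>) ^ (n + 1)))))) \<in> O(\<epsilon>)"
    if eq: "cmod \<alpha> = cmod \<beta>" and cd: "cmod c \<noteq> cmod d \<or>
      (\<exists>m. primitive_root_of_unity m (\<alpha> / \<beta>) \<and> (\<forall>n<m. c * \<alpha> ^ n + d * \<beta> ^ n \<noteq> 0))"
  proof -
    obtain \<delta> where "\<delta> > 0" "\<And>n. \<delta> \<le> cmod (c * (\<alpha> / \<beta>) ^ n + d)"
      using equal_moduli.denominator_bounded_below[OF E[OF eq]] cd unfolding c_def d_def by blast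
    then show ?thesis
      using equal_moduli.approximant_error[OF E[OF eq]]
      unfolding f_def h_def a_def b_def c_def d_def \<epsilon>_def by blast
  qed
  show ?thesis
  proof (intro conjI impI)
    assume "cmod \<alpha> = cmod \<beta> \<and> cmod \<alpha> \<noteq> 0"
    then interpret equal_moduli p q \<alpha> \<beta> by (intro E) simp
    show "convergent (a_seq p q \<alpha> \<beta>)" "convergent (c_seq p q \<alpha> \<beta>)"
      by (rule \<alpha>_limits, unfold_locales)+
    show "convergent (b_seq p q \<alpha> \<beta>)" "convergent (d_seq p q \<alpha> \<beta>)"
      by (rule \<beta>_limits, unfold_locales)+
    show "b = - a_lim p q \<beta> \<alpha>" "d = - c_lim p q \<beta> \<alpha>"
      unfolding b_def d_def by (rule limits_swap)+
  next
    assume "cmod \<alpha> > cmod \<beta>"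
    then show "convergent (a_seq p q \<alpha> \<beta>)" "convergent (c_seq p q \<alpha> \<beta>)"
      by (rule \<alpha>_limits[OF D])+
  next
    assume "cmod \<alpha> < cmod \<beta>"
    then show "convergent (b_seq p q \<alpha> \<beta>)" "convergent (d_seq p q \<alpha> \<beta>)"
      by (rule \<beta>_limits[OF D'])+
  next
    assume "(\<forall>n\<ge>1. pert_A q \<alpha> \<beta> n \<noteq> 0) \<or> cmod \<alpha> = cmod \<beta> \<or>
        lin_frac_set a b c d (power_limit_set (cdiv \<alpha> \<beta>)) \<noteq> {}"
    then show "seq_closure f = lin_frac_set a b c d (power_limit_set (cdiv \<alpha> \<beta>))" by (rule closure)
  next
    assume *: "cmod \<alpha> = cmod \<beta> \<and> cmod \<alpha> \<noteq> 0 \<and> (\<forall>n\<ge>1. q n \<noteq> \<alpha> * \<beta>)"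
    then interpret equal_moduli p q \<alpha> \<beta> by (intro E) simp
    show "asymptotic f (\<lambda>n. h (Fin ((\<alpha> / \<beta>) ^ (n + 1))))"
      unfolding f_def h_def a_def b_def c_def d_def
      by (rule asymptotic_to_linear_fractional) (rule nonzero, use * in simp_all)
    show "convergent_prod (\<lambda>n. 1 - q (Suc n) / (\<alpha> * \<beta>))" by (rule determinant)
    show "a * d - b * c = (\<beta> - \<alpha>) * (\<Prod>n. 1 - q (Suc n) / (\<alpha> * \<beta>))"
      unfolding a_def b_def c_def d_def by (rule determinant)
  next
    assume "cmod \<alpha> = cmod \<beta> \<and> cmod \<alpha> \<noteq> 0 \<and>
        (cmod c \<noteq> cmod d \<or> cmod c = cmod d \<and>
          (\<exists>m. primitive_root_of_unity m (\<alpha> / \<beta>) \<and> (\<forall>n<m. c * \<alpha> ^ n + d * \<beta> ^ n \<noteq> 0)))"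
    then have "cmod \<alpha> = cmod \<beta>" "cmod c \<noteq> cmod d \<or>
        (\<exists>m. primitive_root_of_unity m (\<alpha> / \<beta>) \<and> (\<forall>n<m. c * \<alpha> ^ n + d * \<beta> ^ n \<noteq> 0))"
      by blast+
    note * = rate[OF this]
    show "\<forall>\<^sub>F n in sequentially. f n \<noteq> Infty \<and> h (Fin ((\<alpha> / \<beta>) ^ (n + 1))) \<noteq> Infty"
      by (rule *[THEN conjunct1])
    show "(\<lambda>n. cmod (the_fin (f n) - the_fin (h (Fin ((\<alpha> / \<beta>) ^ (n + 1)))))) \<in> O(\<epsilon>)"
      by (rule *[THEN conjunct2])
  next
    assume unit: "cmod \<alpha> = 1 \<and> cmod \<beta> = 1"
    then interpret equal_moduli p q \<alpha> \<beta> by (intro E) simp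
    note * = convergents_error_unimodular[OF conjunct1[OF unit]]
    show "(\<lambda>n. cmod (P n - (a * \<alpha> ^ (n + 1) + b * \<beta> ^ (n + 1)) / (\<alpha> - \<beta>))) \<in> O(\<epsilon>)"
      unfolding P_def a_def b_def \<epsilon>_def by (rule *(1))
    show "(\<lambda>n. cmod (Q n - (c * \<alpha> ^ (n + 1) + d * \<beta> ^ (n + 1)) / (\<alpha> - \<beta>))) \<in> O(\<epsilon>)"
      unfolding Q_def c_def d_def \<epsilon>_def by (rule *(2))
  qed
qed

end
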